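(* Let $U\subseteq\mathbb{R}^n$ be open and let $\dot x=X(x)$ be a completely integrable dynamical system generated by a smooth vector field $X$ on $U$. Let $k,p\in\mathbb{N}$ with $k+p=n-1$ be such that there exist $n-1$ first integrals $I_1,\dots,I_k,D_1,\dots,D_p\in C^\infty(U,\mathbb{R})$ of $X$, independent on an open subset $V\subseteq U$. Suppose the system $\dot x=X(x)$ admits a $T$-periodic orbit $\Gamma=\{\gamma(t)\in V:0\le t\le T\}$ such that: (i) $\Gamma\subset ID^{-1}(\{0\})$, and $0\in\mathbb{R}^{n-1}$ is a regular value of the map $ID=(I_1,\dots,I_k,D_1,\dots,D_p):V\to\mathbb{R}^{n-1}$; (ii) the vectors $\nabla I_1(\gamma(t)),\dots,\nabla I_k(\gamma(t)),\nabla D_1(\gamma(t)),\dots,\nabla D_p(\gamma(t)),X(\gamma(t))$ are linearly independent for each $0\le t\le T$. For smooth functions $u_1,\dots,u_p\in C^\infty(V,\mathbb{R})$, define the vector field $X_0=X_0^{(u_1,\dots,u_p)}$ on $V$ by $$X_0=\left\|\bigwedge_{i=1}^p\nabla D_i\wedge\bigwedge_{j=1}^k\nabla I_j\right\|_{n-1}^{-2}\cdot\sum_{i=1}^p(-1)^{n-i}u_iD_i\,\Theta_i,$$ $$\Theta_i=\star\left[\bigwedge_{j=1,\,j\ne i}^p\nabla D_j\wedge\bigwedge_{l=1}^k\nabla I_l\wedge\star\left(\bigwedge_{j=1}^p\nabla D_j\wedge\bigwedge_{l=1}^k\nabla I_l\right)\right].$$ If moreover $0\in\mathbb{R}^k$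 is a regular value of the map $I=(I_1,\dots,I_k):V\to\mathbb{R}^k$, then for any choice of smooth functions $h_1,\dots,h_p\in C^\infty(V,\mathbb{R})$ such that $$\int_0^Th_1(\gamma(s))\,ds<0,\ \dots,\ \int_0^Th_p(\gamma(s))\,ds<0,$$ $\Gamma$, as a periodic orbit of the dissipative dynamical system $\dot x=X(x)+X_0^{(h_1,\dots,h_p)}(x)$, $x\in V$, is orbitally phase asymptotically stable with respect to perturbations along the invariant manifold $I^{-1}(\{0\})$. On the other hand, for any choice of smooth functions $k_1,\dots,k_p\in C^\infty(V,\mathbb{R})$ such that there exists $i_0\in\{1,\dots,p\}$ for which $\int_0^Tk_{i_0}(\gamma(s))\,ds>0$, $\Gamma$, as a periodic orbit of the dissipative dynamical system $\dot x=X(x)+X_0^{(k_1,\dots,k_p)}(x)$, $x\in V$, is an unstable periodic orbit.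
   Context: $\mathbb{N}$ includes $0$. $\mathcal{L}_X f=\langle X,\nabla f\rangle$ is the Lie derivative of a smooth function $f$ along $X$, where $\langle\cdot,\cdot\rangle$ is the standard inner product on $\mathbb{R}^n$ and $\nabla$ the corresponding gradient. A first integral of $X$ is a smooth function $f$ with $\mathcal{L}_Xf=0$. A system $\dot x=X(x)$ on an open $U\subseteq\mathbb{R}^n$ is completely integrable if it admits $n-1$ first integrals that are independent at least on an open subset $V\subseteq U$; independent on $V$ means that their gradients are linearly independent at every point of $V$. $\star$ is the Hodge star operator for multivector fields on $\mathbb{R}^n$ with the standard inner product and orientation ($\alpha\wedge\star\beta=\langle\alpha,\beta\rangle\, e_1\wedge\dots\wedge e_n$), and $\|\cdot\|_{n-1}$ is the norm on $(n-1)$-vectors induced by the standard inner product (for a decomposable $(n-1)$-vector, the square root of the Gram determinant of its factors). A codimension-one dissipative dynamical system on $V$ is a system $\dot x=Y(x)$ for which there are $k,p$ with $k+p=n-1$ and smooth functions $I_1,\dots,I_k,D_1,\dots,D_p,h_1,\dots,h_p$ on $V$ with $\mathcal{L}_YI_i=0$ for all $i$ and $\mathcal{L}_YD_j=h_jD_j$ for all $j$. Stability notions for a periodic orbit $\Gamma=\{\gamma(t):0\le t\le T\}$ of a system $\dot x=Y(x)$ on $V$ (here $x(t,x_0)$ denotes the solution with $x(0,x_0)=x_0$, and $\operatorname{dist}$ is the distance from a point to a set): - $\Gamma$ is orbitally stable if for every $\varepsilon>0$ there is $\delta>0$ such that $\operatorname{dist}(x(t,x_0),\Gamma)<\varepsilon$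 for all $t>0$ and all $x_0\in V$ with $\operatorname{dist}(x_0,\Gamma)<\delta$. - $\Gamma$ is unstable if it is not orbitally stable. - $\Gamma$ is orbitally asymptotically stable if it is orbitally stable and (choosing $\delta$ smaller if necessary) $\operatorname{dist}(x(t,x_0),\Gamma)\to0$ as $t\to\infty$ for all $x_0\in V$ with $\operatorname{dist}(x_0,\Gamma)<\delta$. - $\Gamma$ is orbitally phase asymptotically stable if it is orbitally asymptotically stable and there is $\delta>0$ such that for each $x_0\in V$ with $\operatorname{dist}(x_0,\Gamma)<\delta$ there exists $\theta_0=\theta_0(x_0)$ with $\lim_{t\to\infty}\|x(t,x_0)-\gamma(t+\theta_0)\|=0$. "Orbitally phase asymptotically stable with respect to perturbations along the invariant manifold $I^{-1}(\{0\})$" means that $\Gamma$, as a periodic orbit of the restriction of the vector field to the dynamically invariant manifold $I^{-1}(\{0\})\subseteq V$, is orbitally phase asymptotically stable, i.e. for every $\varepsilon>0$ there is $\delta>0$ such that $\operatorname{dist}(x(t,x_0),\Gamma)<\varepsilon$ for all $t>0$ and all $x_0\in I^{-1}(\{0\})$ with $\operatorname{dist}(x_0,\Gamma)<\delta$, and there is $\delta>0$ such that for each $x_0\in I^{-1}(\{0\})$ with $\operatorname{dist}(x_0,\Gamma)<\delta$ one has $\operatorname{dist}(x(t,x_0),\Gamma)\to0$ as $t\to\infty$ and there exists $\theta_0=\theta_0(x_0)$ with $\lim_{t\to\infty}\|x(t,x_0)-\gamma(t+\theta_0)\|=0$. (If $k=0$, then $I^{-1}(\{0\})$ is all of $V$.)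 *)

theory Defs
  imports "HOL-Analysis.Analysis"
begin

section \<open>Smooth functions, gradients, first integrals\<close>

text \<open>\<open>Ck_on k S f\<close> and \<open>smooth_on\<close> are meant for open \<open>S\<close> in a Euclidean space.\<close>

primrec Ck_on :: "nat \<Rightarrow> 'a::real_normed_vector set \<Rightarrow> ('a \<Rightarrow> 'b::real_normed_vector) \<Rightarrow> bool" where
  "Ck_on 0 S f \<longleftrightarrow> continuous_on S f"
| "Ck_on (Suc k) S f \<longleftrightarrow>
     (\<forall>x\<in>S. f differentiable (at x)) \<and> (\<forall>v. Ck_on k S (\<lambda>x. frechet_derivative f (at x) v))"

definition smooth_on :: "'a::real_normed_vector set \<Rightarrow> ('a \<Rightarrow> 'b::real_normed_vector) \<Rightarrow> bool" where
  "smooth_on S f \<longleftrightarrow> (\<forall>k. Ck_on k S f)"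

definition grad :: "('a::real_inner \<Rightarrow> real) \<Rightarrow> 'a \<Rightarrow> 'a" where
  "grad f x = (THE D. GDERIV f x :> D)"

lemma GDERIV_grad:
  fixes f :: "'a::euclidean_space \<Rightarrow> real"
  assumes "f differentiable (at x)"
  shows "GDERIV f x :> grad f x"
proof -
  from assms obtain f' where f': "(f has_derivative f') (at x)"
    unfolding differentiable_def by blast
  interpret f': bounded_linear f' using f' by (rule has_derivative_bounded_linear)
  define D where "D = (\<Sum>b\<in>Basis. f' b *\<^sub>R b)"
  have "f' h = inner h D" for h
  proof -
    have "f' h = f' (\<Sum>b\<in>Basis. inner h b *\<^sub>R b)" by (simp add: euclidean_representation)
    also have "\<dots> = inner h D"
      by (simp add: D_def f'.sum f'.scaleR inner_sum_right mult.commute)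
    finally show ?thesis .
  qed
  then have "f' = (\<lambda>h. inner h D)" by blast
  with f' have D: "GDERIV f x :> D" by (simp add: gderiv_def)
  have "E = D" if "GDERIV f x :> E" for E
  proof -
    have "(\<lambda>h. inner h E) = (\<lambda>h. inner h D)"
      using that D unfolding gderiv_def by (rule has_derivative_unique)
    then show ?thesis by (metis inner_commute vector_eq_rdot)
  qed
  with D show ?thesis unfolding grad_def by (rule theI)
qed

definition lie_derivative :: "('a::real_inner \<Rightarrow> 'a) \<Rightarrow> ('a \<Rightarrow> real) \<Rightarrow> 'a \<Rightarrow> real" where
  "lie_derivative X f x = inner (X x) (grad f x)"

definition first_integral :: "'a::real_inner set \<Rightarrow> ('a \<Rightarrow> 'a) \<Rightarrow> ('a \<Rightarrow> real) \<Rightarrow> bool" where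
  "first_integral U X f \<longleftrightarrow> smooth_on U f \<and> (\<forall>x\<in>U. lie_derivative X f x = 0)"

text \<open>Linear independence of a finite family, given as a list so that repetitions matter.\<close>

definition lin_indep_list :: "'a::real_vector list \<Rightarrow> bool" where
  "lin_indep_list vs \<longleftrightarrow> distinct vs \<and> independent (set vs)"

definition completely_integrable :: "(real^'n) set \<Rightarrow> (real^'n \<Rightarrow> real^'n) \<Rightarrow> bool" where
  "completely_integrable U X \<longleftrightarrow>
     (\<exists>F :: nat \<Rightarrow> real^'n \<Rightarrow> real. \<exists>V. open V \<and> V \<noteq> {} \<and> V \<subseteq> U \<and>
        (\<forall>i\<in>{1..CARD('n) - 1}. first_integral U X (F i)) \<and>
        (\<forall>x\<in>V. lin_indep_list (map (\<lambda>i. grad (F i) x) [1..<CARD('n)])))"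

text \<open>Maps \<open>F = (F\<^sub>1, \<dots>, F\<^sub>m)\<close> into \<open>\<real>\<^sup>m\<close> are families indexed by \<open>{1..m}\<close>;
  the values of \<open>F\<close>, \<open>y\<close> and \<open>c\<close> at other indices are irrelevant.  The case \<open>m = 0\<close> is allowed.\<close>

definition fibre :: "'a set \<Rightarrow> nat \<Rightarrow> (nat \<Rightarrow> 'a \<Rightarrow> real) \<Rightarrow> (nat \<Rightarrow> real) \<Rightarrow> 'a set" where
  "fibre V m F y = {x\<in>V. \<forall>i\<in>{1..m}. F i x = y i}"

definition regular_value ::
    "'a::real_normed_vector set \<Rightarrow> nat \<Rightarrow> (nat \<Rightarrow> 'a \<Rightarrow> real) \<Rightarrow> (nat \<Rightarrow> real) \<Rightarrow> bool" where
  "regular_value V m F y \<longleftrightarrow>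
     (\<forall>x\<in>fibre V m F y. \<forall>c. \<exists>v. \<forall>i\<in>{1..m}. frechet_derivative (F i) (at x) v = c i)"

definition append_map :: "nat \<Rightarrow> (nat \<Rightarrow> 'b) \<Rightarrow> (nat \<Rightarrow> 'b) \<Rightarrow> nat \<Rightarrow> 'b" where
  "append_map k F G i = (if i \<le> k then F i else G (i - k))"

section \<open>Multivectors on \<open>\<real>\<^sup>n\<close>\<close>

text \<open>The exterior algebra of \<open>real^'n\<close> in coordinates: \<open>\<alpha> $ S\<close> is the coefficient of \<open>\<alpha>\<close> at
  \<open>e\<^sub>S = e\<^sub>s \<and> \<dots> \<and> e\<^sub>t\<close>, where \<open>s < \<dots> < t\<close> are the elements of \<open>S\<close>.
  The linear order on \<open>'n\<close> fixes the standard orientation \<open>e\<^sub>U\<^sub>N\<^sub>I\<^sub>V = e\<^sub>1 \<and> \<dots> \<and> e\<^sub>n\<close>.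
  The inner product and norm of \<open>real^('n set)\<close> are those for which the \<open>e\<^sub>S\<close> are orthonormal,
  i.e. the ones induced on multivectors by the standard inner product of \<open>real^'n\<close>.\<close>

type_synonym 'n multivector = "real^('n set)"

text \<open>For disjoint \<open>A\<close> and \<open>B\<close>: \<open>e\<^sub>A \<and> e\<^sub>B = shuffle_sign A B \<cdot> e\<^sub>A\<^sub>\<union>\<^sub>B\<close>.\<close>

definition shuffle_sign :: "'n::linorder set \<Rightarrow> 'n set \<Rightarrow> real" where
  "shuffle_sign A B = (-1) ^ card {(a, b). a \<in> A \<and> b \<in> B \<and> b < a}"

definition wedge :: "'n::{finite,linorder} multivector \<Rightarrow> 'n::{finite,linorder} multivector \<Rightarrow> 'n multivector" where
  "wedge \<alpha> \<beta> = (\<chi> S. \<Sum>A\<in>Pow S. shuffle_sign A (S - A) * \<alpha> $ A * \<beta> $ (S - A))"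

definition of_vector :: "real^'n::finite \<Rightarrow> 'n::finite multivector" where
  "of_vector v = (\<Sum>i\<in>UNIV. v $ i *\<^sub>R axis {i} 1)"

definition vector_part :: "'n::finite multivector \<Rightarrow> real^'n" where
  "vector_part \<alpha> = (\<chi> i. \<alpha> $ {i})"

definition wedge_list :: "(real^'n::{finite,linorder}) list \<Rightarrow> 'n::{finite,linorder} multivector" where
  "wedge_list vs = foldr (\<lambda>v. wedge (of_vector v)) vs (axis {} 1)"

definition hodge :: "'n::{finite,linorder} multivector \<Rightarrow> 'n::{finite,linorder} multivector" where
  "hodge \<beta> = (\<chi> S. shuffle_sign (- S) S * \<beta> $ (- S))"

definition homogeneous :: "nat \<Rightarrow> 'n::finite multivector \<Rightarrow> bool" where
  "homogeneous m \<alpha> \<longleftrightarrow> (\<forall>S. card S \<noteq> m \<longrightarrow> \<alpha> $ S = 0)"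

text \<open>The defining property of the Hodge star operator.\<close>

lemma wedge_hodge:
  fixes \<alpha> \<beta> :: "'n::{finite,linorder} multivector"
  assumes "homogeneous m \<alpha>" "homogeneous m \<beta>"
  shows "wedge \<alpha> (hodge \<beta>) = inner \<alpha> \<beta> *\<^sub>R axis UNIV 1"
proof (subst vec_eq_iff, rule allI)
  fix S :: "'n set"
  have sq: "shuffle_sign A B * shuffle_sign A B = 1" for A B :: "'n set"
    by (simp add: shuffle_sign_def flip: power_add)
  show "wedge \<alpha> (hodge \<beta>) $ S = (inner \<alpha> \<beta> *\<^sub>R axis UNIV 1 :: 'n multivector) $ S"
  proof (cases "S = UNIV")
    case True
    have "shuffle_sign A (- A) * \<alpha> $ A * (shuffle_sign A (- A) * \<beta> $ A) = \<alpha> $ A * \<beta> $ A" for A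
      using sq[of A "- A"] by (metis (no_types, opaque_lifting) mult.assoc mult.commute mult_1)
    then have "wedge \<alpha> (hodge \<beta>) $ UNIV = (\<Sum>A\<in>UNIV. \<alpha> $ A * \<beta> $ A)"
      by (simp only: wedge_def hodge_def vec_lambda_beta Pow_UNIV double_complement
          flip: Compl_eq_Diff_UNIV)
    with True show ?thesis
      by (simp add: inner_vec_def)
  next
    case False
    have "\<alpha> $ A * \<beta> $ (- (S - A)) = 0" if "A \<subseteq> S" for A
    proof (rule ccontr)
      assume "\<alpha> $ A * \<beta> $ (- (S - A)) \<noteq> 0"
      with assms have "card A = m" "card (- (S - A)) = m"
        by (auto simp: homogeneous_def)
      moreover have "- (S - A) = A \<union> - S" using that by blast
      moreover have "card (A \<union> - S) = card A + card (- S)"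
        using that by (intro card_Un_disjoint) auto
      ultimately have "card (- S) = 0" by simp
      with False show False by auto
    qed
    then have "shuffle_sign A (S - A) * \<alpha> $ A * (hodge \<beta> $ (S - A)) = 0" if "A \<subseteq> S" for A
      using that by (auto simp: hodge_def)
    with False show ?thesis
      by (auto simp: wedge_def axis_def intro!: sum.neutral)
  qed
qed

section \<open>The vector field \<open>X\<^sub>0\<close>\<close>

text \<open>In all wedge products the factors are taken in the order
  \<open>\<nabla>D\<^sub>1, \<dots>, \<nabla>D\<^sub>p, \<nabla>I\<^sub>1, \<dots>, \<nabla>I\<^sub>k\<close>.\<close>

definition full_wedge ::
    "nat \<Rightarrow> nat \<Rightarrow> (nat \<Rightarrow> real^'n::{finite,linorder} \<Rightarrow> real) \<Rightarrow> (nat \<Rightarrow> real^'n::{finite,linorder} \<Rightarrow> real) \<Rightarrow>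
     real^'n::{finite,linorder} \<Rightarrow> 'n::{finite,linorder} multivector" where
  "full_wedge k p I D x =
     wedge_list (map (\<lambda>j. grad (D j) x) [1..<Suc p] @ map (\<lambda>l. grad (I l) x) [1..<Suc k])"

definition Theta ::
    "nat \<Rightarrow> nat \<Rightarrow> (nat \<Rightarrow> real^'n::{finite,linorder} \<Rightarrow> real) \<Rightarrow> (nat \<Rightarrow> real^'n::{finite,linorder} \<Rightarrow> real) \<Rightarrow>
     nat \<Rightarrow> real^'n::{finite,linorder} \<Rightarrow> real^'n::{finite,linorder}" where
  "Theta k p I D i x = vector_part (hodge (wedge
     (wedge_list (map (\<lambda>j. grad (D j) x) (filter (\<lambda>j. j \<noteq> i) [1..<Suc p]) @
                  map (\<lambda>l. grad (I l) x) [1..<Suc k]))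
     (hodge (full_wedge k p I D x))))"

definition X0 ::
    "nat \<Rightarrow> nat \<Rightarrow> (nat \<Rightarrow> real^'n::{finite,linorder} \<Rightarrow> real) \<Rightarrow> (nat \<Rightarrow> real^'n::{finite,linorder} \<Rightarrow> real) \<Rightarrow>
     (nat \<Rightarrow> real^'n::{finite,linorder} \<Rightarrow> real) \<Rightarrow> real^'n::{finite,linorder} \<Rightarrow> real^'n::{finite,linorder}" where
  "X0 k p I D u x = inverse ((norm (full_wedge k p I D x))\<^sup>2) *\<^sub>R
     (\<Sum>i = 1..p. ((-1) ^ (CARD('n) - i) * u i x * D i x) *\<^sub>R Theta k p I D i x)"

section \<open>Dissipative systems, periodic orbits and stability\<close>

text \<open>The system \<open>x' = Y(x)\<close> on \<open>V\<close> is codimension-one dissipative, as witnessed by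
  the functions \<open>I\<^sub>i\<close>, \<open>D\<^sub>j\<close>, \<open>h\<^sub>j\<close>.\<close>

definition codim_one_dissipative ::
    "(real^'n) set \<Rightarrow> (real^'n \<Rightarrow> real^'n) \<Rightarrow> nat \<Rightarrow> nat \<Rightarrow> (nat \<Rightarrow> real^'n \<Rightarrow> real) \<Rightarrow>
     (nat \<Rightarrow> real^'n \<Rightarrow> real) \<Rightarrow> (nat \<Rightarrow> real^'n \<Rightarrow> real) \<Rightarrow> bool" where
  "codim_one_dissipative V Y k p I D h \<longleftrightarrow>
     k + p = CARD('n) - 1 \<and>
     (\<forall>i\<in>{1..k}. smooth_on V (I i) \<and> (\<forall>x\<in>V. lie_derivative Y (I i) x = 0)) \<and>
     (\<forall>j\<in>{1..p}. smooth_on V (D j) \<and> smooth_on V (h j) \<and>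
        (\<forall>x\<in>V. lie_derivative Y (D j) x = h j x * D j x))"

text \<open>A periodic orbit is given by a \<open>T\<close>-periodic solution defined for all times;
  \<open>T\<close> is a period, not necessarily the minimal one.\<close>

definition periodic_orbit ::
    "'a::real_normed_vector set \<Rightarrow> ('a \<Rightarrow> 'a) \<Rightarrow> real \<Rightarrow> (real \<Rightarrow> 'a) \<Rightarrow> bool" where
  "periodic_orbit V Y T \<gamma> \<longleftrightarrow>
     T > 0 \<and>
     (\<forall>t. \<gamma> t \<in> V \<and> (\<gamma> has_vector_derivative Y (\<gamma> t)) (at t)) \<and>
     (\<forall>t. \<gamma> (t + T) = \<gamma> t) \<and>
     (\<exists>t. \<gamma> t \<noteq> \<gamma> 0)"

definition forward_solution ::
    "'a::real_normed_vector set \<Rightarrow> ('a \<Rightarrow> 'a) \<Rightarrow> 'a \<Rightarrow> (real \<Rightarrow> 'a) \<Rightarrow> bool" where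
  "forward_solution V Y x0 x \<longleftrightarrow>
     x 0 = x0 \<and>
     (\<forall>t\<ge>0. x t \<in> V \<and> (x has_vector_derivative Y (x t)) (at t within {0..}))"

text \<open>In the following, initial points range over a set \<open>M \<subseteq> V\<close>: \<open>M = V\<close> gives the notions
  for the system on \<open>V\<close>, an invariant \<open>M\<close> those for its restriction to \<open>M\<close>.
  The existential quantifier over forward solutions says that the solution starting at \<open>x0\<close>,
  which is unique on \<open>{0..}\<close> for locally Lipschitz \<open>Y\<close>, exists for all nonnegative times and has
  the stated property.  If \<open>\<Gamma>\<close> is a compact subset of the open set \<open>V\<close>, requiring existence for
  all times adds nothing to orbital stability: for small \<open>\<epsilon>\<close>, a solution
  \<open>\<epsilon>\<close>-close to \<open>\<Gamma>\<close> on its maximal interval of existence is defined for all \<open>t \<ge> 0\<close>.\<close>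

definition orbitally_stable ::
    "'a::real_normed_vector set \<Rightarrow> ('a \<Rightarrow> 'a) \<Rightarrow> 'a set \<Rightarrow> 'a set \<Rightarrow> bool" where
  "orbitally_stable V Y M \<Gamma> \<longleftrightarrow>
     (\<forall>\<epsilon>>0. \<exists>\<delta>>0. \<forall>x0\<in>M. infdist x0 \<Gamma> < \<delta> \<longrightarrow>
        (\<exists>x. forward_solution V Y x0 x \<and> (\<forall>t>0. infdist (x t) \<Gamma> < \<epsilon>)))"

definition orbitally_asymptotically_stable ::
    "'a::real_normed_vector set \<Rightarrow> ('a \<Rightarrow> 'a) \<Rightarrow> 'a set \<Rightarrow> 'a set \<Rightarrow> bool" where
  "orbitally_asymptotically_stable V Y M \<Gamma> \<longleftrightarrow>
     orbitally_stable V Y M \<Gamma> \<and>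
     (\<exists>\<delta>>0. \<forall>x0\<in>M. infdist x0 \<Gamma> < \<delta> \<longrightarrow>
        (\<exists>x. forward_solution V Y x0 x \<and> ((\<lambda>t. infdist (x t) \<Gamma>) \<longlongrightarrow> 0) at_top))"

definition orbitally_phase_asymptotically_stable ::
    "'a::real_normed_vector set \<Rightarrow> ('a \<Rightarrow> 'a) \<Rightarrow> 'a set \<Rightarrow> real \<Rightarrow> (real \<Rightarrow> 'a) \<Rightarrow> bool" where
  "orbitally_phase_asymptotically_stable V Y M T \<gamma> \<longleftrightarrow>
     orbitally_asymptotically_stable V Y M (\<gamma> ` {0..T}) \<and>
     (\<exists>\<delta>>0. \<forall>x0\<in>M. infdist x0 (\<gamma> ` {0..T}) < \<delta> \<longrightarrow>
        (\<exists>x. forward_solution V Y x0 x \<and>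
          (\<exists>\<theta>. ((\<lambda>t. norm (x t - \<gamma> (t + \<theta>))) \<longlongrightarrow> 0) at_top)))"

definition unstable ::
    "'a::real_normed_vector set \<Rightarrow> ('a \<Rightarrow> 'a) \<Rightarrow> 'a set \<Rightarrow> bool" where
  "unstable V Y \<Gamma> \<longleftrightarrow> \<not> orbitally_stable V Y V \<Gamma>"

end

theory Submission
  imports Defs "HOL-Library.Periodic_Fun"
begin

text \<open>Write \<open>Y = X + X\<^sub>0\<close>. Pairing a vector with the Hodge dual of a multivector amounts, up to
  sign, to wedging and reading off the top coefficient. A repeated factor kills a wedge product,
  so \<open>\<Theta>\<^sub>i\<close> is orthogonal to every gradient except \<open>\<nabla>D\<^sub>i\<close>, and the prefactors of \<open>X\<^sub>0\<close> normalise
  the remaining pairing: \<open>Y\<close> keeps every \<open>I\<^sub>l\<close> and satisfies \<open>L\<^sub>Y D\<^sub>j = u\<^sub>j D\<^sub>j\<close> (\<open>inner_X0_I\<close>,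
  \<open>inner_X0_D\<close>). All \<open>D\<^sub>j\<close> vanish on \<open>\<Gamma>\<close>, hence so does \<open>X\<^sub>0\<close>, and \<open>\<gamma>\<close> remains an orbit of \<open>Y\<close>.

  Along a solution \<open>x\<close> of \<open>Y\<close> the function \<open>D\<^sub>j\<close> solves the scalar linear equation \<open>z' =
  u\<^sub>j(x(t)) z\<close>. By continuous dependence a solution that starts close to \<open>\<gamma>(\<theta>)\<close> follows \<open>\<gamma>(\<theta> +
  t)\<close> closely for one period, so in that time \<open>D\<^sub>j\<close> is multiplied by a factor close to the
  exponential of the integral of \<open>u\<^sub>j \<circ> \<gamma>\<close> over a period, uniformly in the phase \<open>\<theta>\<close>
  (\<open>D_over_one_period\<close>).

  If some integral is positive, the corresponding \<open>D\<^sub>j\<close> grows geometrically along any solution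
  that stays near \<open>\<Gamma>\<close> and starts off its zero set, although it is bounded near \<open>\<Gamma>\<close>; so \<open>\<Gamma>\<close> is
  unstable. If all integrals are negative, all \<open>D\<^sub>j\<close> decay geometrically. The gradients of the
  \<open>I\<^sub>l\<close> and \<open>D\<^sub>j\<close> span the normal directions of \<open>\<Gamma>\<close>, so on \<open>I = 0\<close> the distance to \<open>\<Gamma>\<close> is at
  most a constant times the sum of the \<open>|D\<^sub>j|\<close> (\<open>transversal_distance_bound\<close>); it therefore
  decays geometrically as well, and the solution never leaves the region in which these
  estimates hold. For the phase, sample the solution at multiples of the period. As \<open>\<gamma>\<close> returns
  to its starting point, one period moves a sample by at most a constant times its distance to
  \<open>\<Gamma>\<close>. The samples thus form a Cauchy sequence with limit \<open>\<gamma>(\<theta>)\<close> for some \<open>\<theta>\<close>, and continuous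
  dependence carries the convergence from the sampling times to all times (\<open>attraction\<close>).\<close>

section \<open>Exterior algebra and the pairings of \<open>X\<^sub>0\<close> with the gradients\<close>

lemma shuffle_sign_Un_left:
  fixes A B C :: "'n::{finite,linorder} set"
  assumes "A \<inter> B = {}"
  shows "shuffle_sign (A \<union> B) C = shuffle_sign A C * shuffle_sign B C"
proof -
  have "{(a, b). a \<in> A \<union> B \<and> b \<in> C \<and> b < a} =
        {(a, b). a \<in> A \<and> b \<in> C \<and> b < a} \<union> {(a, b). a \<in> B \<and> b \<in> C \<and> b < a}"
    by auto
  moreover have "{(a, b). a \<in> A \<and> b \<in> C \<and> b < a} \<inter> {(a, b). a \<in> B \<and> b \<in> C \<and> b < a} = {}"
    using assms by auto
  ultimately show ?thesis
    by (simp add: shuffle_sign_def card_Un_disjoint power_add)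
qed

lemma shuffle_sign_Un_right:
  fixes A B C :: "'n::{finite,linorder} set"
  assumes "B \<inter> C = {}"
  shows "shuffle_sign A (B \<union> C) = shuffle_sign A B * shuffle_sign A C"
proof -
  have "{(a, b). a \<in> A \<and> b \<in> B \<union> C \<and> b < a} =
        {(a, b). a \<in> A \<and> b \<in> B \<and> b < a} \<union> {(a, b). a \<in> A \<and> b \<in> C \<and> b < a}"
    by auto
  moreover have "{(a, b). a \<in> A \<and> b \<in> B \<and> b < a} \<inter> {(a, b). a \<in> A \<and> b \<in> C \<and> b < a} = {}"
    using assms by auto
  ultimately show ?thesis
    by (simp add: shuffle_sign_def card_Un_disjoint power_add)
qed

lemma shuffle_sign_cases: "shuffle_sign A B = 1 \<or> shuffle_sign A B = -1"
  by (simp add: shuffle_sign_def minus_one_power_iff)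

text \<open>Each pair from \<open>A \<times> B\<close> is an inversion in exactly one of the two orders.\<close>

lemma shuffle_sign_swap:
  fixes A B :: "'n::{finite,linorder} set"
  assumes "A \<inter> B = {}"
  shows "shuffle_sign A B * shuffle_sign B A = (-1) ^ (card A * card B)"
proof -
  let ?P = "{(a, b). a \<in> A \<and> b \<in> B \<and> b < a}"
  let ?Q = "{(a, b). a \<in> A \<and> b \<in> B \<and> a < b}"
  have "?P \<union> ?Q = A \<times> B"
  proof -
    have "b < a \<or> a < b" if "a \<in> A" "b \<in> B" for a b
      using assms that by (metis disjoint_iff neqE)
    then show ?thesis by auto
  qed
  moreover have "?P \<inter> ?Q = {}" by auto
  moreover have "finite ?P" "finite ?Q"
    by (auto intro: finite_subset[OF _ finite])
  ultimately have "card ?P + card ?Q = card A * card B"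
    using card_Un_disjoint[of ?P ?Q] card_cartesian_product[of A B] by simp
  moreover have "card {(a, b). a \<in> B \<and> b \<in> A \<and> b < a} = card ?Q"
    by (rule bij_betw_same_card[of prod.swap]) (auto simp: bij_betw_def inj_on_def image_iff)
  ultimately show ?thesis
    by (simp add: shuffle_sign_def flip: power_add)
qed

lemma shuffle_sign_singletons:
  fixes i j :: "'n::{finite,linorder}"
  assumes "i \<noteq> j"
  shows "shuffle_sign {i} {j} * shuffle_sign {j} {i} = -1"
  using shuffle_sign_swap[of "{i}" "{j}"] assms by simp

lemma shuffle_sign_insert_right:
  fixes i j :: "'n::{finite,linorder}"
  assumes "j \<notin> S"
  shows "shuffle_sign {i} (insert j S) = shuffle_sign {i} {j} * shuffle_sign {i} S"
  using shuffle_sign_Un_right[of "{j}" S "{i}"] assms by simp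

text \<open>Both bracketings sum over the ways to split \<open>S\<close> into three blocks \<open>B\<close>, \<open>C\<close>, \<open>R\<close>; the signs
  agree because the number of inversions is additive in each argument.\<close>

lemma wedge_assoc:
  fixes \<alpha> \<beta> \<gamma> :: "'n::{finite,linorder} multivector"
  shows "wedge (wedge \<alpha> \<beta>) \<gamma> = wedge \<alpha> (wedge \<beta> \<gamma>)"
proof (subst vec_eq_iff, rule allI)
  fix S :: "'n set"
  have "wedge (wedge \<alpha> \<beta>) \<gamma> $ S =
      (\<Sum>A\<in>Pow S. \<Sum>B\<in>Pow A. shuffle_sign A (S - A) * (shuffle_sign B (A - B) * \<alpha> $ B * \<beta> $ (A - B))
          * \<gamma> $ (S - A))"
    by (simp add: wedge_def sum_distrib_left sum_distrib_right)
  also have "\<dots> = (\<Sum>(A,B)\<in>Sigma (Pow S) Pow. shuffle_sign A (S - A)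
      * (shuffle_sign B (A - B) * \<alpha> $ B * \<beta> $ (A - B)) * \<gamma> $ (S - A))"
    by (rule sum.Sigma) auto
  also have "\<dots> = (\<Sum>(B,C)\<in>Sigma (Pow S) (\<lambda>B. Pow (S - B)).
      shuffle_sign B (S - B) * \<alpha> $ B * (shuffle_sign C (S - B - C) * \<beta> $ C * \<gamma> $ (S - B - C)))"
  proof (rule sum.reindex_bij_witness[where j = "\<lambda>(A,B). (B, A - B)" and i = "\<lambda>(B,C).
      (B \<union> C, B)"], goal_cases)
    case (5 x)
    obtain A B where x: "x = (A, B)" "A \<subseteq> S" "B \<subseteq> A" using 5 by auto
    define C where "C = A - B"
    define R where "R = S - A"
    have A: "A = B \<union> C" and d: "B \<inter> C = {}" "C \<inter> R = {}"
      and e: "S - B = C \<union> R" "S - B - C = R"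
      using x by (auto simp: C_def R_def)
    have "shuffle_sign A R * shuffle_sign B C = shuffle_sign B (C \<union> R) * shuffle_sign C R"
      unfolding A using d by (simp add: shuffle_sign_Un_left shuffle_sign_Un_right)
    then show ?case
      unfolding x using e by (simp add: C_def[symmetric] R_def[symmetric] algebra_simps)
  qed auto
  also have "\<dots> = (\<Sum>B\<in>Pow S. \<Sum>C\<in>Pow (S - B). shuffle_sign B (S - B) * \<alpha> $ B
      * (shuffle_sign C (S - B - C) * \<beta> $ C * \<gamma> $ (S - B - C)))"
    by (rule sum.Sigma[symmetric]) auto
  also have "\<dots> = wedge \<alpha> (wedge \<beta> \<gamma>) $ S"
    by (simp add: wedge_def sum_distrib_left)
  finally show "wedge (wedge \<alpha> \<beta>) \<gamma> $ S = wedge \<alpha> (wedge \<beta> \<gamma>) $ S" .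
qed

lemma wedge_scaleR_right: "wedge \<alpha> (c *\<^sub>R \<beta>) = c *\<^sub>R wedge \<alpha> \<beta>"
  by (simp add: wedge_def vec_eq_iff sum_distrib_left algebra_simps)

lemma wedge_scaleR_left: "wedge (c *\<^sub>R \<alpha>) \<beta> = c *\<^sub>R wedge \<alpha> \<beta>"
  by (simp add: wedge_def vec_eq_iff sum_distrib_left algebra_simps)

lemma wedge_zero [simp]: "wedge \<alpha> 0 = 0" "wedge 0 \<alpha> = 0"
  by (simp_all add: wedge_def vec_eq_iff)

lemma of_vector_nth: "of_vector v $ A = (\<Sum>i\<in>UNIV. if A = {i} then v $ i else 0)"
  by (simp add: of_vector_def axis_def if_distrib cong: if_cong)

lemma of_vector_singleton [simp]: "of_vector v $ {i} = v $ i"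
  by (simp add: of_vector_nth)

lemma of_vector_non_singleton: "(\<And>i. A \<noteq> {i}) \<Longrightarrow> of_vector v $ A = 0"
  by (simp add: of_vector_nth)

lemma wedge_of_vector_nth:
  fixes \<alpha> :: "'n::{finite,linorder} multivector"
  shows "wedge (of_vector v) \<alpha> $ S = (\<Sum>i\<in>S. shuffle_sign {i} (S - {i}) * v $ i * \<alpha> $ (S - {i}))"
proof -
  have "wedge (of_vector v) \<alpha> $ S =
      (\<Sum>A\<in>(\<lambda>i. {i}) ` S. shuffle_sign A (S - A) * of_vector v $ A * \<alpha> $ (S - A))"
    unfolding wedge_def vec_lambda_beta
    by (rule sum.mono_neutral_right) (auto intro!: of_vector_non_singleton)
  also have "\<dots> = (\<Sum>i\<in>S. shuffle_sign {i} (S - {i}) * v $ i * \<alpha> $ (S - {i}))"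
    by (subst sum.reindex) (auto simp: inj_on_def)
  finally show ?thesis .
qed

text \<open>Exchanging the two factors transposes the indices \<open>i\<close> and \<open>j\<close> removed from \<open>S\<close>; the sign
  changes since exactly one of \<open>i < j\<close> and \<open>j < i\<close> holds.\<close>

lemma wedge_of_vector_anticommute:
  fixes \<alpha> :: "'n::{finite,linorder} multivector"
  shows "wedge (of_vector v) (wedge (of_vector w) \<alpha>) =
      - wedge (of_vector w) (wedge (of_vector v) \<alpha>)"
proof (subst vec_eq_iff, rule allI)
  fix S :: "'n set"
  define t where "t = (\<lambda>v w (i, j). shuffle_sign {i} (S - {i}) * v $ i *
     (shuffle_sign {j} (S - {i} - {j}) * w $ j * \<alpha> $ (S - {i} - {j})))"
  have expand: "wedge (of_vector v) (wedge (of_vector w) \<alpha>) $ S =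
      (\<Sum>ij\<in>Sigma S (\<lambda>i. S - {i}). t v w ij)"
    for v w :: "real^'n::{finite,linorder}"
    unfolding wedge_of_vector_nth sum_distrib_left t_def by (rule sum.Sigma) auto
  have "(\<Sum>ij\<in>Sigma S (\<lambda>i. S - {i}). t v w ij) = (\<Sum>ij\<in>Sigma S (\<lambda>i. S - {i}). - t w v ij)"
  proof (rule sum.reindex_bij_witness[where j = prod.swap and i = prod.swap], goal_cases)
    case (5 x)
    obtain i j where x: "x = (i, j)" "i \<in> S" "j \<in> S" "i \<noteq> j" using 5 by auto
    define R where "R = S - {i} - {j}"
    have R: "S - {i} = insert j R" "S - {j} = insert i R" "i \<notin> R" "j \<notin> R"
      using x by (auto simp: R_def)
    have D: "insert j R - {j} = R" "insert i R - {i} = R" using R(3,4) by auto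
    have "shuffle_sign {j} {i} = - shuffle_sign {i} {j}"
      using shuffle_sign_singletons[OF x(4)] shuffle_sign_cases[of "{i}" "{j}"] by auto
    then show ?case
      unfolding x t_def prod.swap_def fst_conv snd_conv prod.case R(1,2) D
        shuffle_sign_insert_right[OF R(3)] shuffle_sign_insert_right[OF R(4)]
      by (simp add: mult_ac)
  qed auto
  then show "wedge (of_vector v) (wedge (of_vector w) \<alpha>) $ S =
    (- wedge (of_vector w) (wedge (of_vector v) \<alpha>)) $ S"
    unfolding vector_uminus_component expand by (simp add: sum_negf)
qed

lemma wedge_of_vector_self [simp]:
  fixes \<alpha> :: "'n::{finite,linorder} multivector"
  shows "wedge (of_vector v) (wedge (of_vector v) \<alpha>) = 0"
  using wedge_of_vector_anticommute[of v v \<alpha>] by (simp add: vec_eq_iff)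

lemma wedge_list_Cons [simp]: "wedge_list (v # vs) = wedge (of_vector v) (wedge_list vs)"
  by (simp add: wedge_list_def)

lemma wedge_repeated_factor:
  "v \<in> set vs \<Longrightarrow> wedge (of_vector v) (wedge_list vs) = 0"
proof (induction vs)
  case (Cons w ws)
  then show ?case
    by (cases "w = v") (simp_all add: wedge_of_vector_anticommute[of v w])
qed simp

lemma wedge_move_factor:
  "wedge (of_vector v) (wedge_list (us @ vs)) = (-1) ^ length us *\<^sub>R wedge_list (us @ v # vs)"
proof (induction us)
  case (Cons u us)
  then show ?case
    by (simp add: wedge_of_vector_anticommute[of v u] wedge_scaleR_right)
qed simp

text \<open>Contraction with \<open>v\<close>, the adjoint of the left exterior multiplication by \<open>v\<close>.\<close>

definition interior_product :: "real^'n::{finite,linorder} \<Rightarrow> 'n multivector \<Rightarrow> 'n multivector" where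
  "interior_product v \<alpha> = (\<chi> S. \<Sum>i\<in>-S. shuffle_sign {i} S * v $ i * \<alpha> $ insert i S)"

text \<open>The antiderivation rule. The terms in which the index inserted by the contraction is the
  one removed by the product add up to \<open>\<langle>v, w\<rangle> \<alpha>\<close>, one part coming from indices outside \<open>S\<close> and
  the other from indices in \<open>S\<close>; all other terms cancel in pairs.\<close>

lemma interior_product_wedge:
  fixes \<alpha> :: "'n::{finite,linorder} multivector"
  shows "interior_product v (wedge (of_vector w) \<alpha>) =
    inner v w *\<^sub>R \<alpha> - wedge (of_vector w) (interior_product v \<alpha>)"
proof (subst vec_eq_iff, rule allI)
  fix S :: "'n set"
  define R where "R = (\<lambda>i j. shuffle_sign {j} (S - {j}) * w $ j
      * (shuffle_sign {i} (S - {j}) * v $ i * \<alpha> $ insert i (S - {j})))"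
  have "interior_product v (wedge (of_vector w) \<alpha>) $ S =
     (\<Sum>i\<in>-S. shuffle_sign {i} S * v $ i *
        (\<Sum>j\<in>insert i S. shuffle_sign {j} (insert i S - {j}) * w $ j * \<alpha> $ (insert i S - {j})))"
    by (simp add: interior_product_def wedge_of_vector_nth)
  also have "\<dots> = (\<Sum>i\<in>-S. v $ i * w $ i * \<alpha> $ S - (\<Sum>j\<in>S. R i j))"
  proof (rule sum.cong[OF refl])
    fix i assume "i \<in> - S"
    then have i: "i \<notin> S" by simp
    have "shuffle_sign {i} S * v $ i * (shuffle_sign {j} (insert i S - {j}) * w $ j
        * \<alpha> $ (insert i S - {j}))
        = - R i j" if j: "j \<in> S" for j
    proof -
      define Q where "Q = S - {j}"
      have ij: "i \<noteq> j" using i j by auto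
      have Q: "S = insert j Q" "insert i S - {j} = insert i Q" "i \<notin> Q" "j \<notin> Q"
        using i j ij by (auto simp: Q_def)
      have "shuffle_sign {i} {j} * (shuffle_sign {j} {i} * r) = - r" for r
        using shuffle_sign_singletons[OF ij] by (simp flip: mult.assoc)
      then show ?thesis
        unfolding R_def Q_def[symmetric] Q(2) shuffle_sign_insert_right[OF Q(3)]
          arg_cong[OF Q(1), of "shuffle_sign {i}"] shuffle_sign_insert_right[OF Q(4)]
        by (simp add: mult_ac)
    qed
    then have "(\<Sum>j\<in>S. shuffle_sign {i} S * v $ i
        * (shuffle_sign {j} (insert i S - {j}) * w $ j * \<alpha> $ (insert i S - {j})))
       = - (\<Sum>j\<in>S. R i j)"
      by (simp add: sum_negf)
    moreover have "shuffle_sign {i} S * v $ i * (shuffle_sign {i} S * w $ i * \<alpha> $ S) = v $ i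
        * w $ i * \<alpha> $ S"
      using shuffle_sign_cases[of "{i}" S] by auto
    ultimately show "shuffle_sign {i} S * v $ i *
        (\<Sum>j\<in>insert i S. shuffle_sign {j} (insert i S - {j}) * w $ j * \<alpha> $ (insert i S - {j})) =
        v $ i * w $ i * \<alpha> $ S - (\<Sum>j\<in>S. R i j)"
      using i by (simp add: distrib_left sum_distrib_left)
  qed
  also have "\<dots> = (\<Sum>i\<in>-S. v $ i * w $ i * \<alpha> $ S) - (\<Sum>j\<in>S. \<Sum>i\<in>-S. R i j)"
    by (simp add: sum_subtractf sum.swap[of _ S])
  also have "(\<Sum>j\<in>S. \<Sum>i\<in>-S. R i j) = (\<Sum>j\<in>S. (\<Sum>i\<in>-(S - {j}). R i j) - v $ j * w $ j * \<alpha> $ S)"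
  proof (rule sum.cong[OF refl])
    fix j assume j: "j \<in> S"
    have "R j j = v $ j * w $ j * \<alpha> $ S"
      using shuffle_sign_cases[of "{j}" "S - {j}"] j by (auto simp: R_def insert_absorb)
    moreover have "- (S - {j}) = insert j (- S)" using j by auto
    ultimately show "(\<Sum>i\<in>-S. R i j) = (\<Sum>i\<in>-(S - {j}). R i j) - v $ j * w $ j * \<alpha> $ S"
      using j by simp
  qed
  also have "\<dots> = wedge (of_vector w) (interior_product v \<alpha>) $ S - (\<Sum>j\<in>S. v $ j * w $ j * \<alpha> $ S)"
    by (simp only: wedge_of_vector_nth interior_product_def R_def sum_distrib_left sum_subtractf
        vec_lambda_beta)
  also have "(\<Sum>i\<in>-S. v $ i * w $ i * \<alpha> $ S) - (wedge (of_vector w) (interior_product v \<alpha>) $ S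
      - (\<Sum>j\<in>S. v $ j * w $ j * \<alpha> $ S))
     = inner v w * \<alpha> $ S - wedge (of_vector w) (interior_product v \<alpha>) $ S"
  proof -
    have "inner v w * \<alpha> $ S = (\<Sum>i\<in>S \<union> - S. v $ i * w $ i * \<alpha> $ S)"
      by (simp add: inner_vec_def sum_distrib_right)
    also have "\<dots> = (\<Sum>i\<in>S. v $ i * w $ i * \<alpha> $ S) + (\<Sum>i\<in>-S. v $ i * w $ i * \<alpha> $ S)"
      by (rule sum.union_disjoint) auto
    finally show ?thesis by simp
  qed
  finally show "interior_product v (wedge (of_vector w) \<alpha>) $ S =
    (inner v w *\<^sub>R \<alpha> - wedge (of_vector w) (interior_product v \<alpha>)) $ S" by simp
qed

lemma interior_product_orthogonal:
  fixes vs :: "(real^'n::{finite,linorder}) list"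
  assumes "\<And>w. w \<in> set vs \<Longrightarrow> inner v w = 0"
  shows "interior_product v (wedge_list vs) = 0"
  using assms
proof (induction vs)
  case Nil
  then show ?case
    by (simp add: interior_product_def wedge_list_def axis_def vec_eq_iff)
next
  case (Cons w ws)
  then show ?case by (simp add: interior_product_wedge)
qed

text \<open>Contract with the component \<open>z\<close> of the first vector that is orthogonal to the others: this
  removes the first factor and multiplies the rest by \<open>\<langle>z, z\<rangle> \<noteq> 0\<close>.\<close>

lemma wedge_list_nonzero:
  fixes vs :: "(real^'n::{finite,linorder}) list"
  assumes "lin_indep_list vs"
  shows "wedge_list vs \<noteq> 0"
  using assms
proof (induction vs)
  case Nil
  then show ?case by (simp add: wedge_list_def)
next
  case (Cons w ws)
  have ws: "lin_indep_list ws" and w: "w \<notin> span (set ws)"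
    using Cons.prems by (auto simp: lin_indep_list_def independent_insert split: if_splits)
  obtain y z where y: "y \<in> span (set ws)" and z: "\<And>u. u \<in> span (set ws) \<Longrightarrow> orthogonal z u"
    and wyz: "w = y + z"
    using orthogonal_subspace_decomp_exists[of "set ws" w] by blast
  have "inner z u = 0" if "u \<in> set ws" for u
    using z[of u] that by (simp add: span_base orthogonal_def)
  then have "interior_product z (wedge_list ws) = 0"
    by (rule interior_product_orthogonal)
  then have *: "interior_product z (wedge_list (w # ws)) = inner z w *\<^sub>R wedge_list ws"
    by (simp add: interior_product_wedge)
  have "z \<noteq> 0" using w wyz y by auto
  moreover have "inner z w = inner z z"
    using z[OF y] by (simp add: wyz inner_add_right orthogonal_def)
  ultimately have "inner z w *\<^sub>R wedge_list ws \<noteq> 0"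
    using Cons.IH[OF ws] by simp
  moreover have "interior_product z 0 = 0" by (simp add: interior_product_def vec_eq_iff)
  ultimately show ?case using * by metis
qed

text \<open>This turns inner products with \<open>\<Theta>\<^sub>i\<close> into top coefficients of wedge products, where
  associativity and anticommutativity apply. The sign is that of moving \<open>v\<close> past \<open>n - 1\<close>
  factors.\<close>

lemma inner_vector_part_hodge:
  fixes v :: "real^'n::{finite,linorder}"
  shows "inner (vector_part (hodge \<beta>)) v = (-1) ^ (CARD('n) - 1) * wedge (of_vector v) \<beta> $ UNIV"
proof -
  have "shuffle_sign (- {i}) {i} = (-1) ^ (CARD('n) - 1) * shuffle_sign {i} (- {i})" for i :: 'n
  proof -
    have "shuffle_sign {i} (- {i}) * shuffle_sign (- {i}) {i} = (-1) ^ (CARD('n) - 1)"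
      by (subst shuffle_sign_swap) (auto simp: Compl_eq_Diff_UNIV card_Diff_singleton)
    then show ?thesis using shuffle_sign_cases[of "{i}" "-{i}"] by auto
  qed
  then have "inner (vector_part (hodge \<beta>)) v =
     (\<Sum>i\<in>UNIV. (-1) ^ (CARD('n) - 1) * (shuffle_sign {i} (- {i}) * v $ i * \<beta> $ (- {i})))"
    by (simp add: inner_vec_def vector_part_def hodge_def algebra_simps)
  then show ?thesis
    by (simp add: wedge_of_vector_nth sum_distrib_left Compl_eq_Diff_UNIV)
qed

lemma wedge_hodge_self_UNIV:
  fixes \<alpha> :: "'n::{finite,linorder} multivector"
  shows "wedge \<alpha> (hodge \<alpha>) $ UNIV = (norm \<alpha>)\<^sup>2"
proof -
  have "shuffle_sign A (- A) * \<alpha> $ A * (shuffle_sign A (- A) * \<alpha> $ A) = \<alpha> $ A * \<alpha> $ A" for A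
    using shuffle_sign_cases[of A "- A"] by auto
  then have "wedge \<alpha> (hodge \<alpha>) $ UNIV = (\<Sum>A\<in>UNIV. \<alpha> $ A * \<alpha> $ A)"
    by (simp only: wedge_def hodge_def vec_lambda_beta Pow_UNIV double_complement
          flip: Compl_eq_Diff_UNIV)
  then show ?thesis by (simp add: power2_norm_eq_inner inner_vec_def)
qed

lemma inner_Theta_repeated:
  assumes "v \<in> set (map (\<lambda>j. grad (D j) x) (filter (\<lambda>j. j \<noteq> i) [1..<Suc p]) @
                  map (\<lambda>l. grad (I l) x) [1..<Suc k])"
  shows "inner (Theta k p I D i x) v = 0"
  unfolding Theta_def inner_vector_part_hodge wedge_assoc[symmetric]
  using wedge_repeated_factor[OF assms] by simp

text \<open>Moving \<open>\<nabla>D\<^sub>i\<close> to its place in the product costs \<open>i - 1\<close> transpositions and restores the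
  full wedge \<open>W\<close>; then \<open>W \<and> \<star>W\<close> has top coefficient \<open>\<parallel>W\<parallel>\<^sup>2\<close>. The parities of \<open>n - 1\<close> and \<open>i - 1\<close>
  combine to that of \<open>n - i\<close>, the sign in the definition of \<open>X\<^sub>0\<close>.\<close>

lemma inner_Theta_same:
  fixes I D :: "nat \<Rightarrow> real^'n::{finite,linorder} \<Rightarrow> real"
  assumes i: "i \<in> {1..p}" and "p < CARD('n)"
  shows "inner (Theta k p I D i x) (grad (D i) x) = (-1) ^ (CARD('n) - i)
      * (norm (full_wedge k p I D x))\<^sup>2"
proof -
  define W where "W = full_wedge k p I D x"
  have upt1: "[1..<Suc p] = [1..<i] @ i # [Suc i..<Suc p]"
    using i upt_add_eq_append[of 1 i "Suc p - i"] upt_conv_Cons[of i "Suc p"] by simp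
  have flt: "filter (\<lambda>j. j \<noteq> i) [1..<Suc p] = [1..<i] @ [Suc i..<Suc p]"
    unfolding upt1 filter_append by (auto simp: filter_id_conv)
  let ?w = "wedge_list (map (\<lambda>j. grad (D j) x) (filter (\<lambda>j. j \<noteq> i) [1..<Suc p]) @
                  map (\<lambda>l. grad (I l) x) [1..<Suc k])"
  have "wedge (of_vector (grad (D i) x)) ?w = (-1) ^ (i - 1) *\<^sub>R W"
    unfolding flt W_def full_wedge_def upt1
    using wedge_move_factor[of "grad (D i) x" "map (\<lambda>j. grad (D j) x) [1..<i]"]
    by simp
  then have "inner (Theta k p I D i x) (grad (D i) x) = (-1) ^ (CARD('n) - 1) * (-1) ^ (i - 1)
      * (norm W)\<^sup>2"
    unfolding Theta_def inner_vector_part_hodge wedge_assoc[symmetric] W_def[symmetric]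
    by (simp add: wedge_scaleR_left wedge_hodge_self_UNIV)
  moreover have "(-1) ^ (CARD('n) - 1) * (-1) ^ (i - 1) = ((-1) ^ (CARD('n) - i) :: real)"
  proof -
    have "CARD('n) - 1 = (CARD('n) - i) + (i - 1)" using assms by auto
    then show ?thesis by (simp add: power_add mult.assoc flip: power_mult_distrib)
  qed
  ultimately show ?thesis by (simp add: W_def)
qed

lemma lin_indep_list_swap: "lin_indep_list (us @ vs) \<longleftrightarrow> lin_indep_list (vs @ us)"
  by (auto simp: lin_indep_list_def Un_commute)

lemma inner_X0_D:
  fixes I D :: "nat \<Rightarrow> real^'n::{finite,linorder} \<Rightarrow> real"
  assumes "p < CARD('n)" and j: "j \<in> {1..p}" and W: "full_wedge k p I D x \<noteq> 0"
  shows "inner (X0 k p I D u x) (grad (D j) x) = u j x * D j x"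
proof -
  define w where "w = (norm (full_wedge k p I D x))\<^sup>2"
  have w: "w \<noteq> 0" using W by (simp add: w_def)
  have "(\<Sum>i = 1..p. ((-1) ^ (CARD('n) - i) * u i x * D i x)
      * inner (Theta k p I D i x) (grad (D j) x))
     = (\<Sum>i = 1..p. if i = j then w * (u i x * D i x) else 0)"
  proof (rule sum.cong[OF refl])
    fix i assume i: "i \<in> {1..p}"
    show "((-1) ^ (CARD('n) - i) * u i x * D i x) * inner (Theta k p I D i x) (grad (D j) x) =
       (if i = j then w * (u i x * D i x) else 0)"
    proof (cases "i = j")
      case True
      have "inner (Theta k p I D i x) (grad (D j) x) = (-1) ^ (CARD('n) - i) * w"
        unfolding True[symmetric] w_def by (rule inner_Theta_same[OF i assms(1)])
      moreover have "(-1) ^ (CARD('n) - i) * (-1) ^ (CARD('n) - i) = (1::real)"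
        by (simp flip: power_mult_distrib)
      ultimately show ?thesis using True by (simp add: algebra_simps) 
    next
      case False
      have "inner (Theta k p I D i x) (grad (D j) x) = 0"
        using False j by (intro inner_Theta_repeated) (simp add: image_iff del: upt_Suc, force)
      then show ?thesis using False by simp
    qed
  qed
  also have "\<dots> = w * (u j x * D j x)" using j by simp
  finally show ?thesis
    using w by (simp add: X0_def w_def[symmetric] inner_sum_left)
qed

lemma inner_X0_I:
  assumes "l \<in> {1..k}"
  shows "inner (X0 k p I D u x) (grad (I l) x) = 0"
proof -
  have "inner (Theta k p I D i x) (grad (I l) x) = 0" for i
    using assms by (intro inner_Theta_repeated) (simp add: image_iff del: upt_Suc, force)
  then show ?thesis by (simp add: X0_def inner_sum_left)
qed

section \<open>Lipschitz continuity on compact sets\<close>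

text \<open>On an open set of a Euclidean space this is local Lipschitz continuity. The form with
  compact sets makes closure under products and inverses immediate, since Lipschitz functions
  are bounded on a compact set.\<close>

definition lip_on_compacts :: "'a::metric_space set \<Rightarrow> ('a \<Rightarrow> 'b::metric_space) \<Rightarrow> bool" where
  "lip_on_compacts V f \<longleftrightarrow> (\<forall>K. compact K \<longrightarrow> K \<subseteq> V \<longrightarrow> (\<exists>L. L-lipschitz_on K f))"

lemma lip_on_compactsE:
  assumes "lip_on_compacts V f" "compact K" "K \<subseteq> V"
  obtains L where "L \<ge> 0" "L-lipschitz_on K f"
  using assms unfolding lip_on_compacts_def by (meson lipschitz_on_nonneg)

lemma lip_on_compacts_const [simp]: "lip_on_compacts V (\<lambda>x. c)"
  unfolding lip_on_compacts_def using lipschitz_on_constant by blast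

lemma lip_on_compacts_add:
  fixes f g :: "'a::metric_space \<Rightarrow> 'b::real_normed_vector"
  assumes "lip_on_compacts V f" "lip_on_compacts V g"
  shows "lip_on_compacts V (\<lambda>x. f x + g x)"
  using assms unfolding lip_on_compacts_def by (blast intro: lipschitz_on_add)

lemma lip_on_compacts_sum:
  fixes f :: "'i \<Rightarrow> 'a::metric_space \<Rightarrow> 'b::real_normed_vector"
  assumes "\<And>i. i \<in> A \<Longrightarrow> lip_on_compacts V (f i)"
  shows "lip_on_compacts V (\<lambda>x. \<Sum>i\<in>A. f i x)"
  using assms by (induction A rule: infinite_finite_induct) (auto intro: lip_on_compacts_add)

lemma lipschitz_on_compact_bounded:
  fixes f :: "'a::metric_space \<Rightarrow> 'b::real_normed_vector"
  assumes "L-lipschitz_on K f" "compact K"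
  obtains B where "B \<ge> 0" "\<And>x. x \<in> K \<Longrightarrow> norm (f x) \<le> B"
proof -
  have "bounded (f ` K)"
    using assms by (intro compact_imp_bounded compact_continuous_image lipschitz_on_continuous_on)
  then obtain B where "\<forall>x\<in>K. norm (f x) \<le> B" by (auto simp: bounded_iff)
  then have "\<And>x. x \<in> K \<Longrightarrow> norm (f x) \<le> max 0 B" by fastforce
  then show ?thesis using that[of "max 0 B"] by simp
qed

lemma lip_on_compacts_scaleR:
  fixes f :: "'a::metric_space \<Rightarrow> real" and g :: "'a \<Rightarrow> 'b::real_normed_vector"
  assumes "lip_on_compacts V f" "lip_on_compacts V g"
  shows "lip_on_compacts V (\<lambda>x. f x *\<^sub>R g x)"
  unfolding lip_on_compacts_def
proof (intro allI impI)
  fix K assume K: "compact K" "K \<subseteq> V"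
  obtain L where L: "L \<ge> 0" "L-lipschitz_on K f" by (rule lip_on_compactsE[OF assms(1) K])
  obtain M where M: "M \<ge> 0" "M-lipschitz_on K g" by (rule lip_on_compactsE[OF assms(2) K])
  obtain B where B: "B \<ge> 0" "\<And>x. x \<in> K \<Longrightarrow> norm (f x) \<le> B"
    using lipschitz_on_compact_bounded[OF L(2) K(1)] by blast
  obtain C where C: "C \<ge> 0" "\<And>x. x \<in> K \<Longrightarrow> norm (g x) \<le> C"
    using lipschitz_on_compact_bounded[OF M(2) K(1)] by blast
  have "(B * M + L * C)-lipschitz_on K (\<lambda>x. f x *\<^sub>R g x)"
  proof (rule lipschitz_onI)
    fix x y assume xy: "x \<in> K" "y \<in> K"
    have "f x *\<^sub>R g x - f y *\<^sub>R g y = f x *\<^sub>R (g x - g y) + (f x - f y) *\<^sub>R g y"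
      by (simp add: algebra_simps)
    then have "norm (f x *\<^sub>R g x - f y *\<^sub>R g y) \<le> \<bar>f x\<bar> * norm (g x - g y) + \<bar>f x - f y\<bar>
        * norm (g y)"
      by (metis norm_triangle_ineq norm_scaleR)
    also have "\<dots> \<le> B * (M * dist x y) + (L * dist x y) * C"
      using B C L M xy lipschitz_onD[OF L(2) xy] lipschitz_onD[OF M(2) xy]
      by (intro add_mono mult_mono) (auto simp: dist_norm)
    finally show "dist (f x *\<^sub>R g x) (f y *\<^sub>R g y) \<le> (B * M + L * C) * dist x y"
      by (simp add: dist_norm algebra_simps)
  qed (use B C L M in auto)
  then show "\<exists>L. L-lipschitz_on K (\<lambda>x. f x *\<^sub>R g x)" by blast
qed

lemma lip_on_compacts_mult:
  fixes f g :: "'a::metric_space \<Rightarrow> real"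
  assumes "lip_on_compacts V f" "lip_on_compacts V g"
  shows "lip_on_compacts V (\<lambda>x. f x * g x)"
  using lip_on_compacts_scaleR[OF assms] by simp

lemma lip_on_compacts_inverse:
  fixes f :: "'a::metric_space \<Rightarrow> real"
  assumes "lip_on_compacts V f" and nz: "\<And>x. x \<in> V \<Longrightarrow> f x \<noteq> 0"
  shows "lip_on_compacts V (\<lambda>x. inverse (f x))"
  unfolding lip_on_compacts_def
proof (intro allI impI)
  fix K assume K: "compact K" "K \<subseteq> V"
  obtain L where L: "L \<ge> 0" "L-lipschitz_on K f" by (rule lip_on_compactsE[OF assms(1) K])
  have "continuous_on K (\<lambda>x. inverse (f x))"
    using nz K lipschitz_on_continuous_on[OF L(2)] by (intro continuous_on_inverse) auto
  then have "bounded ((\<lambda>x. inverse (f x)) ` K)"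
    using K by (intro compact_imp_bounded compact_continuous_image)
  then obtain B where B: "\<And>x. x \<in> K \<Longrightarrow> \<bar>inverse (f x)\<bar> \<le> B" by (auto simp: bounded_iff)
  have "(B * L * B)-lipschitz_on K (\<lambda>x. inverse (f x))" if "K \<noteq> {}"
  proof (rule lipschitz_onI)
    have B0: "0 \<le> B" using that B by (meson abs_ge_zero ex_in_conv order_trans)
    then show "0 \<le> B * L * B" using L by simp
    fix x y assume xy: "x \<in> K" "y \<in> K"
    have "f x \<noteq> 0" "f y \<noteq> 0" using nz xy K by auto
    then have "\<bar>inverse (f x) - inverse (f y)\<bar> = \<bar>inverse (f x)\<bar> * \<bar>f x - f y\<bar> * \<bar>inverse (f y)\<bar>"
      by (simp add: field_simps abs_minus_commute flip: abs_mult)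
    also have "\<dots> \<le> B * (L * dist x y) * B"
      using B xy lipschitz_onD[OF L(2) xy] B0 L by (intro mult_mono) (auto simp: dist_norm)
    finally show "dist (inverse (f x)) (inverse (f y)) \<le> B * L * B * dist x y"
      by (simp add: dist_norm algebra_simps)
  qed
  then show "\<exists>L. L-lipschitz_on K (\<lambda>x. inverse (f x))"
    by (cases "K = {}") (auto intro: exI[of _ 0])
qed

lemma lip_on_compacts_vec:
  fixes f :: "'a::metric_space \<Rightarrow> real^'m"
  assumes "\<And>i. lip_on_compacts V (\<lambda>x. f x $ i)"
  shows "lip_on_compacts V f"
proof -
  have "lip_on_compacts V (\<lambda>x. \<Sum>i\<in>UNIV. (f x $ i) *\<^sub>R axis i (1::real))"
    by (intro lip_on_compacts_sum lip_on_compacts_scaleR assms lip_on_compacts_const)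
  moreover have "(\<Sum>i\<in>UNIV. (f x $ i) *\<^sub>R axis i (1::real)) = f x" for x
    using basis_expansion[of "f x"] by (simp add: scalar_mult_eq_scaleR)
  ultimately show ?thesis by simp
qed

text \<open>Directional derivatives along a basis are locally bounded, hence so is the norm of the
  derivative; the mean value inequality on balls and compactness do the rest.\<close>

lemma Ck_on_1_imp_lip_on_compacts:
  fixes f :: "'a::euclidean_space \<Rightarrow> 'b::real_normed_vector"
  assumes "Ck_on (Suc 0) V f" "open V"
  shows "lip_on_compacts V f"
  unfolding lip_on_compacts_def
proof (intro allI impI)
  fix K assume K: "compact K" "K \<subseteq> V"
  have diff: "(f has_derivative frechet_derivative f (at x)) (at x)" if "x \<in> V" for x
    using assms(1) that by (simp add: frechet_derivative_works)
  have cont: "continuous_on V (\<lambda>x. frechet_derivative f (at x) v)" for v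
    using assms(1) by simp
  have "local_lipschitz {0::real} V (\<lambda>t. f)"
  proof (rule local_lipschitzI)
    fix x assume "x \<in> V"
    then obtain u where u: "u > 0" "cball x u \<subseteq> V"
      using assms(2) open_contains_cball by blast
    have "\<forall>b\<in>Basis. \<exists>B. \<forall>y\<in>cball x u. norm (frechet_derivative f (at y) b) \<le> B"
    proof
      fix b :: 'a
      have "bounded ((\<lambda>y. frechet_derivative f (at y) b) ` cball x u)"
        using cont u by (intro compact_imp_bounded compact_continuous_image
            continuous_on_subset[OF cont]) auto
      then show "\<exists>B. \<forall>y\<in>cball x u. norm (frechet_derivative f (at y) b) \<le> B"
        by (auto simp: bounded_iff)
    qed
    then obtain B where B: "\<And>b y. b \<in> Basis \<Longrightarrow> y \<in> cball x u \<Longrightarrow>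
        norm (frechet_derivative f (at y) b) \<le> B b"
      by metis
    define C where "C = (\<Sum>b\<in>Basis. B b)"
    have bnd: "norm (frechet_derivative f (at y) v) \<le> C * norm v" if y: "y \<in> cball x u" for y v
    proof -
      interpret bounded_linear "frechet_derivative f (at y)"
        using diff[of y] u y by (intro has_derivative_bounded_linear) auto
      have "frechet_derivative f (at y) v = (\<Sum>b\<in>Basis. (v \<bullet> b) *\<^sub>R frechet_derivative f (at y) b)"
        by (subst euclidean_representation[of v, symmetric]) (simp only: sum scaleR)
      also have "norm \<dots> \<le> (\<Sum>b\<in>Basis. norm v * B b)"
      proof (rule order_trans[OF norm_sum], rule sum_mono)
        fix b :: 'a assume "b \<in> Basis"
        then show "norm ((v \<bullet> b) *\<^sub>R frechet_derivative f (at y) b) \<le> norm v * B b"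
          using B[OF _ y] Basis_le_norm[of b v] by (auto intro!: mult_mono)
      qed
      also have "\<dots> = C * norm v" unfolding C_def sum_distrib_left[symmetric] by (rule mult.commute)
      finally show ?thesis .
    qed
    have C0: "C \<ge> 0"
      unfolding C_def using B[of _ x] u
      by (intro sum_nonneg) (meson centre_in_cball less_imp_le norm_ge_zero order_trans)
    have "C-lipschitz_on (cball x u) f"
    proof (rule bounded_derivative_imp_lipschitz[OF _ convex_cball _ C0])
      fix y assume y: "y \<in> cball x u"
      show "(f has_derivative frechet_derivative f (at y)) (at y within cball x u)"
        by (rule has_derivative_at_withinI[OF diff]) (use y u in auto)
      show "onorm (frechet_derivative f (at y)) \<le> C"
        by (rule onorm_le) (rule bnd[OF y])
    qed
    then have "C-lipschitz_on (cball x u \<inter> V) f"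
      by (rule lipschitz_on_subset) simp
    then show "\<exists>u>0. \<exists>L. \<forall>t\<in>cball t u \<inter> {0::real}. L-lipschitz_on (cball x u \<inter> V) f" for t
      using u(1) by blast
  qed
  then have "local_lipschitz {0::real} K (\<lambda>t. f)"
    by (rule local_lipschitz_subset) (use K in auto)
  then obtain L where "\<And>t::real. t \<in> {0} \<Longrightarrow> L-lipschitz_on K f"
    by (rule local_lipschitz_compact_implies_lipschitz[OF _ K(1) compact_sing[of "0::real"]]) auto
  then show "\<exists>L. L-lipschitz_on K f" by blast
qed

lemma smooth_on_imp_lip_on_compacts:
  fixes f :: "'a::euclidean_space \<Rightarrow> 'b::real_normed_vector"
  assumes "smooth_on V f" "open V"
  shows "lip_on_compacts V f"
  using assms Ck_on_1_imp_lip_on_compacts unfolding smooth_on_def by blast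

lemma Ck_on_subset: "Ck_on m S f \<Longrightarrow> T \<subseteq> S \<Longrightarrow> Ck_on m T f"
  by (induction m arbitrary: f) (auto intro: continuous_on_subset)

lemma smooth_on_subset: "smooth_on S f \<Longrightarrow> T \<subseteq> S \<Longrightarrow> smooth_on T f"
  by (auto simp: smooth_on_def intro: Ck_on_subset)

lemma smooth_on_differentiable: "smooth_on S f \<Longrightarrow> x \<in> S \<Longrightarrow> f differentiable (at x)"
  unfolding smooth_on_def by (metis Ck_on.simps(2))

lemma smooth_on_GDERIV:
  fixes f :: "'a::euclidean_space \<Rightarrow> real"
  assumes "smooth_on S f" "x \<in> S"
  shows "GDERIV f x :> grad f x"
  using assms by (intro GDERIV_grad smooth_on_differentiable)

lemma grad_inner_eq_frechet:
  fixes f :: "'a::euclidean_space \<Rightarrow> real"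
  assumes "f differentiable (at x)"
  shows "frechet_derivative f (at x) v = inner v (grad f x)"
  using fun_cong[OF frechet_derivative_at[of f "\<lambda>h. inner h (grad f x)" x],
      of v] GDERIV_grad[OF assms]
  by (simp add: gderiv_def)

lemma smooth_on_grad_continuous:
  fixes f :: "'a::euclidean_space \<Rightarrow> real"
  assumes "smooth_on S f"
  shows "continuous_on S (\<lambda>x. inner v (grad f x))"
proof -
  have "Ck_on (Suc 0) S f" using assms unfolding smooth_on_def by blast
  then have "continuous_on S (\<lambda>x. frechet_derivative f (at x) v)" by simp
  then show ?thesis
    by (rule continuous_on_eq) (simp add: grad_inner_eq_frechet smooth_on_differentiable[OF assms])
qed

lemma lip_on_compacts_cong:
  assumes "lip_on_compacts V f" "\<And>x. x \<in> V \<Longrightarrow> f x = g x"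
  shows "lip_on_compacts V g"
  unfolding lip_on_compacts_def
proof (intro allI impI)
  fix K assume K: "compact K" "K \<subseteq> V"
  then obtain L where "L-lipschitz_on K f" using assms(1) unfolding lip_on_compacts_def by blast
  then have "L-lipschitz_on K g"
    by (rule lipschitz_on_transform) (use assms(2) K in auto)
  then show "\<exists>L. L-lipschitz_on K g" by blast
qed

lemma smooth_on_grad_lip:
  fixes f :: "'a::euclidean_space \<Rightarrow> real"
  assumes "smooth_on S f" "open S"
  shows "lip_on_compacts S (\<lambda>x. inner v (grad f x))"
proof -
  have "Ck_on (Suc (Suc 0)) S f" using assms unfolding smooth_on_def by blast
  then have "Ck_on (Suc 0) S (\<lambda>x. frechet_derivative f (at x) v)" by (subst (asm) Ck_on.simps) blast
  from Ck_on_1_imp_lip_on_compacts[OF this assms(2)] show ?thesis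
    by (rule lip_on_compacts_cong) (simp add: grad_inner_eq_frechet
        smooth_on_differentiable[OF assms(1)])
qed

section \<open>Differential equations\<close>

lemma nonincreasing_from_derivative:
  fixes \<phi> d :: "real \<Rightarrow> real"
  assumes "a \<le> b"
    and "\<And>t. t \<in> {a..b} \<Longrightarrow> (\<phi> has_real_derivative d t) (at t within {a..b})"
    and "\<And>t. t \<in> {a..b} \<Longrightarrow> d t \<le> 0"
  shows "\<phi> b \<le> \<phi> a"
proof (rule DERIV_nonpos_imp_decreasing_open[OF assms(1)])
  fix t assume t: "a < t" "t < b"
  then have "at t within {a..b} = at t" by (intro at_within_interior) simp
  then show "\<exists>y. DERIV \<phi> t :> y \<and> y \<le> 0"
    using assms(2)[of t] assms(3)[of t] t by (intro exI[of _ "d t"]) auto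
next
  show "continuous_on {a..b} \<phi>"
    using assms(2) by (intro DERIV_continuous_on)
qed

text \<open>Gronwall argument: \<open>exp (- 2 L t) \<parallel>x(t) - y(t)\<parallel>\<^sup>2\<close> is nonincreasing.\<close>

lemma lipschitz_ode_continuous_dependence:
  fixes x y :: "real \<Rightarrow> 'a::real_inner"
  assumes L: "L-lipschitz_on S f" and "0 \<le> \<tau>"
    and x: "\<And>t. t \<in> {0..\<tau>} \<Longrightarrow> x t \<in> S \<and> (x has_vector_derivative f (x t)) (at t within {0..\<tau>})"
    and y: "\<And>t. t \<in> {0..\<tau>} \<Longrightarrow> y t \<in> S \<and> (y has_vector_derivative f (y t)) (at t within {0..\<tau>})"
  shows "norm (x \<tau> - y \<tau>) \<le> exp (L * \<tau>) * norm (x 0 - y 0)"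
proof -
  define \<phi> where "\<phi> = (\<lambda>t. exp (- 2 * L * t) * ((x t - y t) \<bullet> (x t - y t)))"
  define d where "d = (\<lambda>t. exp (- 2 * L * t) * (2 * ((x t - y t) \<bullet> (f (x t) - f (y t)))) - 2 * L
      * exp (- 2 * L * t) * ((x t - y t) \<bullet> (x t - y t)))"
  have "\<phi> \<tau> \<le> \<phi> 0"
  proof (rule nonincreasing_from_derivative[OF assms(2)])
    fix t assume t: "t \<in> {0..\<tau>}"
    have z: "((\<lambda>t. x t - y t) has_derivative (\<lambda>h. h *\<^sub>R (f (x t) - f (y t)))) (at t within {0..\<tau>})"
      using has_vector_derivative_diff[of x _ _ y] x[OF t] y[OF t]
          unfolding has_vector_derivative_def[symmetric] by blast
    have e: "((\<lambda>t. exp (- 2 * L * t)) has_derivative (\<lambda>h. h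
        * (- 2 * L * exp (- 2 * L * t)))) (at t within {0..\<tau>})"
      by (auto intro!: derivative_eq_intros)
    show "(\<phi> has_real_derivative d t) (at t within {0..\<tau>})"
      unfolding \<phi>_def has_field_derivative_def
      by (rule has_derivative_eq_rhs[OF has_derivative_mult[OF e has_derivative_inner[OF z z]]])
         (auto simp: d_def fun_eq_iff algebra_simps inner_commute)
    have "(x t - y t) \<bullet> (f (x t) - f (y t)) \<le> norm (x t - y t) * norm (f (x t) - f (y t))"
      by (rule norm_cauchy_schwarz)
    also have "\<dots> \<le> norm (x t - y t) * (L * norm (x t - y t))"
      using lipschitz_onD[OF L, of "x t" "y t"] x[OF t] y[OF t]
          by (intro mult_left_mono) (auto simp: dist_norm)
    also have "\<dots> = L * ((x t - y t) \<bullet> (x t - y t))"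
      by (simp add: dot_square_norm power2_eq_square)
    finally have "exp (- 2 * L * t) * (2 * ((x t - y t) \<bullet> (f (x t) - f (y t)))) \<le>
        exp (- 2 * L * t) * (2 * (L * ((x t - y t) \<bullet> (x t - y t))))"
      by (intro mult_left_mono) auto
    then show "d t \<le> 0" by (simp add: d_def algebra_simps)
  qed
  then have "exp (- 2 * L * \<tau>) * (norm (x \<tau> - y \<tau>))\<^sup>2 \<le> (norm (x 0 - y 0))\<^sup>2"
    by (simp add: \<phi>_def dot_square_norm)
  then have "exp (2 * L * \<tau>) * (exp (- 2 * L * \<tau>) * (norm (x \<tau> - y \<tau>))\<^sup>2) \<le> exp (2 * L * \<tau>)
      * (norm (x 0 - y 0))\<^sup>2"
    by (rule mult_left_mono) simp
  moreover have "exp (2 * L * \<tau>) * (exp (- 2 * L * \<tau>) * (norm (x \<tau> - y \<tau>))\<^sup>2) =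
      (norm (x \<tau> - y \<tau>))\<^sup>2"
    by (simp add: exp_minus)
  moreover have "exp (2 * L * \<tau>) = (exp (L * \<tau>))\<^sup>2" by (simp add: power2_eq_square flip: exp_add)
  ultimately have "(norm (x \<tau> - y \<tau>))\<^sup>2 \<le> (exp (L * \<tau>) * norm (x 0 - y 0))\<^sup>2"
    unfolding power_mult_distrib by (simp only:)
  then show ?thesis by (rule power2_le_imp_le) simp
qed

text \<open>With \<open>B\<close> an antiderivative of \<open>b\<close>, the function \<open>z\<^sup>2 exp (- 2 B)\<close> is nonincreasing. Having
  \<open>b\<close> apart from \<open>a\<close> allows the coefficient along a solution to be replaced by the one along \<open>\<gamma>\<close>
  plus an error bound.\<close>

lemma linear_ode_upper_bound:
  fixes z a b :: "real \<Rightarrow> real"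
  assumes "0 \<le> \<tau>" and b: "continuous_on {0..\<tau>} b"
    and z: "\<And>t. t \<in> {0..\<tau>} \<Longrightarrow> (z has_real_derivative a t * z t) (at t within {0..\<tau>})"
    and ab: "\<And>t. t \<in> {0..\<tau>} \<Longrightarrow> a t \<le> b t"
  shows "\<bar>z \<tau>\<bar> \<le> exp (integral {0..\<tau>} b) * \<bar>z 0\<bar>"
proof -
  define B where "B = (\<lambda>t. integral {0..t} b)"
  have B: "(B has_real_derivative b t) (at t within {0..\<tau>})" if "t \<in> {0..\<tau>}" for t
    unfolding B_def has_real_derivative_iff_has_vector_derivative
    by (rule integral_has_vector_derivative[OF b that])
  define \<phi> where "\<phi> = (\<lambda>t. (z t)\<^sup>2 * exp (- 2 * B t))"
  have "\<phi> \<tau> \<le> \<phi> 0"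
  proof (rule nonincreasing_from_derivative[OF assms(1)])
    fix t assume t: "t \<in> {0..\<tau>}"
    show "(\<phi> has_real_derivative 2 * (a t - b t)
        * ((z t)\<^sup>2 * exp (- 2 * B t))) (at t within {0..\<tau>})"
      unfolding \<phi>_def by (rule derivative_eq_intros z[OF t] B[OF t] refl | simp)+
         (simp add: algebra_simps power2_eq_square)
    show "2 * (a t - b t) * ((z t)\<^sup>2 * exp (- 2 * B t)) \<le> 0"
      by (rule mult_nonpos_nonneg) (use ab[OF t] in auto)
  qed
  then have "(z \<tau>)\<^sup>2 * exp (- 2 * B \<tau>) \<le> (z 0)\<^sup>2" by (simp add: \<phi>_def B_def)
  then have "exp (2 * B \<tau>) * ((z \<tau>)\<^sup>2 * exp (- 2 * B \<tau>)) \<le> exp (2 * B \<tau>) * (z 0)\<^sup>2"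
    by (rule mult_left_mono) simp
  moreover have "exp (2 * B \<tau>) * ((z \<tau>)\<^sup>2 * exp (- 2 * B \<tau>)) = (z \<tau>)\<^sup>2"
    by (simp add: exp_minus)
  moreover have "exp (2 * B \<tau>) = (exp (B \<tau>))\<^sup>2" by (simp add: power2_eq_square flip: exp_add)
  ultimately have "\<bar>z \<tau>\<bar>\<^sup>2 \<le> (exp (B \<tau>) * \<bar>z 0\<bar>)\<^sup>2"
    unfolding power_mult_distrib power2_abs by (simp only:)
  then show ?thesis unfolding B_def by (rule power2_le_imp_le) simp
qed

text \<open>The upper bound for the time-reversed equation.\<close>

lemma linear_ode_lower_bound:
  fixes z a b :: "real \<Rightarrow> real"
  assumes "0 \<le> \<tau>" and b: "continuous_on {0..\<tau>} b"
    and z: "\<And>t. t \<in> {0..\<tau>} \<Longrightarrow> (z has_real_derivative a t * z t) (at t within {0..\<tau>})"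
    and ab: "\<And>t. t \<in> {0..\<tau>} \<Longrightarrow> b t \<le> a t"
  shows "exp (integral {0..\<tau>} b) * \<bar>z 0\<bar> \<le> \<bar>z \<tau>\<bar>"
proof -
  define w where "w = (\<lambda>t. z (\<tau> - t))"
  have w: "(w has_real_derivative - a (\<tau> - t) * w t) (at t within {0..\<tau>})" if t: "t \<in> {0..\<tau>}" for t
  proof -
    have im: "(\<lambda>t. \<tau> - t) ` {0..\<tau>} = {0..\<tau>}" by (auto simp: image_iff intro!: bexI[of _ "\<tau> - _"])
    have "((\<lambda>t. \<tau> - t) has_real_derivative - 1) (at t within {0..\<tau>})"
      by (auto intro!: derivative_eq_intros)
    from DERIV_image_chain[OF _ this, of z "a (\<tau> - t) * z (\<tau> - t)"] z[of "\<tau> - t"] t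
    show ?thesis by (simp add: w_def o_def im)
  qed
  have "\<bar>w \<tau>\<bar> \<le> exp (integral {0..\<tau>} (\<lambda>t. - b (\<tau> - t))) * \<bar>w 0\<bar>"
    by (rule linear_ode_upper_bound[OF assms(1) _ w])
       (use ab in \<open>auto intro!: continuous_intros continuous_on_compose2[OF b]\<close>)
  also have "integral {0..\<tau>} (\<lambda>t. - b (\<tau> - t)) = - integral {0..\<tau>} b"
  proof -
    have "(b has_integral integral {0..\<tau>} b) {0..\<tau>}"
      using b by (intro integrable_integral integrable_continuous_real)
    from has_integral_affinity[OF this[unfolded cbox_interval[symmetric]], of "-1" \<tau>]
    have "((\<lambda>t. b (\<tau> - t)) has_integral integral {0..\<tau>} b) {0..\<tau>}"
      using assms(1) by (simp add: image_affinity_atLeastAtMost_diff cong: image_cong)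
    then show ?thesis by (simp add: integral_unique)
  qed
  finally have "\<bar>z 0\<bar> \<le> exp (- integral {0..\<tau>} b) * \<bar>z \<tau>\<bar>" by (simp add: w_def)
  then have "exp (integral {0..\<tau>} b) * \<bar>z 0\<bar> \<le> exp (integral {0..\<tau>} b)
      * (exp (- integral {0..\<tau>} b) * \<bar>z \<tau>\<bar>)"
    by (rule mult_left_mono) simp
  then show ?thesis by (simp flip: mult.assoc exp_add)
qed

lemma periodic_integral_shift:
  fixes g :: "real \<Rightarrow> real"
  assumes cont: "continuous_on UNIV g" and per: "\<And>t. g (t + T) = g t" and \<theta>: "\<theta> \<in> {0..T}"
  shows "integral {0..T} (\<lambda>s. g (\<theta> + s)) = integral {0..T} g"
proof -
  have int: "g integrable_on {a..b}" for a b
    by (intro integrable_continuous_real continuous_on_subset[OF cont]) auto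
  have shift: "integral {a..b} (\<lambda>s. g (s + c)) = integral {a + c..b + c} g" for a b c
    using integral_shift[of a c b g] continuous_on_subset[OF cont] by (simp add: o_def)
  have "integral {0..T} (\<lambda>s. g (\<theta> + s)) = integral {\<theta>..T + \<theta>} g"
    using shift[of 0 T \<theta>] by (simp add: add.commute)
  also have "\<dots> = integral {\<theta>..T} g + integral {T..T + \<theta>} g"
    using \<theta> by (intro Henstock_Kurzweil_Integration.integral_combine[symmetric] int) auto
  also have "integral {T..T + \<theta>} g = integral {0..\<theta>} g"
    using shift[of 0 \<theta> T] per by (simp add: add.commute)
  also have "integral {\<theta>..T} g + integral {0..\<theta>} g = integral {0..T} g"
    using \<theta> Henstock_Kurzweil_Integration.integral_combine[of 0 \<theta> T g] int by simp
  finally show ?thesis .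
qed

text \<open>A fixed point of the integral equation on all of \<open>[0, \<infinity>)\<close> at once. The unknown is the
  displacement \<open>x - x0\<close> scaled by \<open>exp (- 2 K t)\<close>, which is a bounded function because \<open>f\<close> is
  bounded; with \<open>K \<ge> L\<close> the weight makes the integral operator a contraction by the factor \<open>1/2\<close>
  in the supremum norm.\<close>

lemma lipschitz_ode_global_solution:
  fixes f :: "'a::banach \<Rightarrow> 'a"
  assumes L: "L-lipschitz_on UNIV f" and B: "\<And>v. norm (f v) \<le> B"
  obtains x where "x 0 = x0" "\<And>t. t \<ge> 0 \<Longrightarrow> (x has_vector_derivative f (x t)) (at t within {0..})"
proof -
  define K where "K = L + 1"
  have L0: "L \<ge> 0" using L by (rule lipschitz_on_nonneg)
  have B0: "B \<ge> 0" using B norm_ge_zero order_trans by blast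
  have K: "K > 0" "L \<le> K" using L0 by (auto simp: K_def)
  have fcont: "continuous_on UNIV f" using L by (rule lipschitz_on_continuous_on)
  define g where "g = (\<lambda>(y :: real \<Rightarrow>\<^sub>C 'a) s. f (x0 + exp (2 * K * s) *\<^sub>R y s))"
  define G where "G = (\<lambda>y t. integral {0..t} (g y))"
  \<comment> \<open>The cut at \<open>0\<close> extends the function constantly to negative times, where nothing is claimed.\<close>
  define F where "F = (\<lambda>y t. exp (- 2 * K * max 0 t) *\<^sub>R G y (max 0 t))"
  have gcont: "continuous_on S (g y)" for S y
    unfolding g_def by (intro continuous_on_compose2[OF fcont] continuous_intros) auto
  have G_deriv: "(G y has_vector_derivative g y t) (at t within {0..})" if t: "t \<ge> 0" for y t
  proof -
    have "(G y has_vector_derivative g y t) (at t within {0..t+1})"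
      unfolding G_def using t by (intro integral_has_vector_derivative gcont) auto
    moreover have "at t within {0..t+1} = at t within {0..}"
      by (rule at_within_nhd[of _ "{..<t+1}"]) auto
    ultimately show ?thesis by simp
  qed
  have Gcont: "continuous_on {0..} (G y)" for y
    using G_deriv by (intro continuous_on_vector_derivative) auto
  have G_bound: "norm (G y t) \<le> B * t" if "t \<ge> 0" for y t
    using integral_bound[of 0 t "g y" B] that gcont B by (simp add: G_def g_def)
  have Fcont: "continuous_on UNIV (F y)" for y
    unfolding F_def by (intro continuous_intros continuous_on_compose2[OF Gcont]) auto
  have F_bound: "norm (F y t) \<le> B / K" for y t
  proof -
    define u where "u = max 0 t"
    have u: "u \<ge> 0" unfolding u_def by (rule max.cobounded1)
    have "K * u \<le> exp (2 * K * u)"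
      using exp_ge_add_one_self[of "2 * K * u"] K u mult_nonneg_nonneg[of K u] by linarith
    then have "exp (- (2 * K * u)) * (K * u) \<le> 1"
      by (simp add: exp_minus field_simps)
    then have "B * (exp (- (2 * K * u)) * (K * u)) \<le> B * 1" by (rule mult_left_mono[OF _ B0])
    then have "exp (- (2 * K * u)) * (B * u) \<le> B / K" using K by (simp add: field_simps)
    moreover have "norm (F y t) \<le> exp (- (2 * K * u)) * (B * u)"
      using G_bound[OF u, of y] by (simp add: F_def u_def)
    ultimately show ?thesis by linarith
  qed
  define \<Phi> where "\<Phi> = (\<lambda>y. Bcontfun (F y))"
  have \<Phi>: "apply_bcontfun (\<Phi> y) = F y" for y
    unfolding \<Phi>_def using Fcont F_bound by (intro Bcontfun_inverse bcontfun_normI)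
  have contr: "dist (\<Phi> y) (\<Phi> z) \<le> 1/2 * dist y z" for y z
  proof (rule dist_bound)
    fix t :: real
    define u where "u = max 0 t"
    define d where "d = dist y z"
    have u: "u \<ge> 0" unfolding u_def by (rule max.cobounded1)
    have gint: "g w integrable_on {0..u}" for w by (intro integrable_continuous_real gcont)
    have E: "((\<lambda>s. K * d * exp (2 * K * s)) has_integral (d / 2 * exp (2 * K * u) - d / 2
        * exp (2 * K * 0))) {0..u}"
      by (rule fundamental_theorem_of_calculus[OF u])
         (auto intro!: derivative_eq_intros simp flip:
             has_real_derivative_iff_has_vector_derivative)
    have "norm (G y u - G z u) = norm (integral {0..u} (\<lambda>s. g y s - g z s))"
      by (simp add: G_def integral_diff gint)
    also have "\<dots> \<le> integral {0..u} (\<lambda>s. K * d * exp (2 * K * s))"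
    proof (rule integral_norm_bound_integral)
      show "(\<lambda>s. g y s - g z s) integrable_on {0..u}" by (intro integrable_diff gint)
      show "(\<lambda>s. K * d * exp (2 * K * s)) integrable_on {0..u}" using E by blast
      fix s
      have "norm (g y s - g z s) \<le> L * norm (exp (2 * K * s) *\<^sub>R y s - exp (2 * K * s) *\<^sub>R z s)"
        using lipschitz_onD[OF L, of "x0 + exp (2 * K * s) *\<^sub>R y s" "x0 + exp (2 * K * s) *\<^sub>R z s"]
        by (simp add: g_def dist_norm)
      also have "\<dots> = L * (exp (2 * K * s) * dist (y s) (z s))"
        by (simp add: dist_norm flip: scaleR_diff_right)
      also have "\<dots> \<le> K * (exp (2 * K * s) * d)"
        using K L0 dist_bounded[of y s z] by (intro mult_mono) (auto simp: d_def)
      finally show "norm (g y s - g z s) \<le> K * d * exp (2 * K * s)" by (simp add: mult_ac)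
    qed
    also have "\<dots> \<le> d / 2 * exp (2 * K * u)"
      unfolding integral_unique[OF E] by (simp add: d_def)
    finally have "exp (- 2 * K * u) * norm (G y u - G z u) \<le> exp (- 2 * K * u)
        * (d / 2 * exp (2 * K * u))"
      by (intro mult_left_mono) auto
    also have "\<dots> = d / 2" by (simp add: exp_minus)
    finally show "dist (apply_bcontfun (\<Phi> y) t) (apply_bcontfun (\<Phi> z) t) \<le> 1/2 * dist y z"
      by (simp add: \<Phi> F_def dist_norm u_def d_def flip: scaleR_diff_right)
  qed
  have "\<exists>!y. \<Phi> y = y"
    by (rule banach_fix_type[of "1/2"]) (use contr in auto)
  then obtain y where y: "\<Phi> y = y" by blast
  define x where "x = (\<lambda>t. x0 + G y t)"
  have xg: "g y t = f (x t)" if "t \<ge> 0" for t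
  proof -
    have "apply_bcontfun y t = exp (- 2 * K * t) *\<^sub>R G y t"
      using \<Phi>[of y] that by (simp add: y F_def)
    then show ?thesis by (simp add: g_def x_def flip: exp_add)
  qed
  show ?thesis
  proof (rule that[of x])
    show "x 0 = x0" by (simp add: x_def G_def)
    show "(x has_vector_derivative f (x t)) (at t within {0..})" if "t \<ge> 0" for t
      unfolding x_def using G_deriv[OF that, of y] xg[OF that]
      by (auto intro!: derivative_eq_intros simp: x_def)
  qed
qed

section \<open>Neighbourhoods of a periodic orbit\<close>

lemma grad_mean_value:
  fixes f :: "'a::euclidean_space \<Rightarrow> real"
  assumes "\<And>z. z \<in> closed_segment a b \<Longrightarrow> GDERIV f z :> grad f z"
  obtains \<xi> where "\<xi> \<in> closed_segment a b" "f b - f a = (b - a) \<bullet> grad f \<xi>"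
proof -
  define c where "c = (\<lambda>t::real. a + t *\<^sub>R (b - a))"
  have c: "c t \<in> closed_segment a b" if "0 \<le> t" "t \<le> 1" for t
    using that by (auto simp: closed_segment_def c_def algebra_simps intro!: exI[of _ t])
  have "DERIV (\<lambda>t. f (c t)) t :> (b - a) \<bullet> grad f (c t)" if t: "0 \<le> t" "t \<le> 1" for t
  proof -
    have "(c has_derivative (\<lambda>h. h *\<^sub>R (b - a))) (at t)"
      unfolding c_def by (auto intro!: derivative_eq_intros)
    from has_derivative_compose[OF this assms[OF c[OF t], unfolded gderiv_def]]
    show ?thesis by (simp add: has_field_derivative_def mult_commute_abs)
  qed
  from MVT2[of 0 1, OF _ this] obtain t where
    "0 < t" "t < 1" "f (c 1) - f (c 0) = (b - a) \<bullet> grad f (c t)" by auto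
  then show ?thesis using that[OF c[of t]] by (simp add: c_def)
qed

lemma lin_indep_list_orthogonal_zero:
  fixes v :: "real^'n"
  assumes "lin_indep_list vs" "length vs = CARD('n)" "\<And>w. w \<in> set vs \<Longrightarrow> v \<bullet> w = 0"
  shows "v = 0"
proof -
  have ind: "independent (set vs)" and "card (set vs) = CARD('n)"
    using assms(1,2) by (auto simp: lin_indep_list_def distinct_card)
  then have "v \<in> span (set vs)"
    using card_ge_dim_independent[of "set vs" UNIV] by auto
  then have "orthogonal v v"
    by (rule orthogonal_to_span) (use assms(3) in \<open>auto simp: orthogonal_def\<close>)
  then show ?thesis by (simp add: orthogonal_def)
qed

lemma smooth_on_continuous_grad:
  fixes f :: "'a::euclidean_space \<Rightarrow> real"
  assumes "smooth_on S f"
  shows "continuous_on S (grad f)"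
  using smooth_on_grad_continuous[OF assms]
  by (intro continuous_on_componentwise[THEN iffD2]) (simp add: inner_commute)

lemma has_vector_derivative_window:
  fixes x :: "real \<Rightarrow> 'a::real_normed_vector"
  assumes "(x has_vector_derivative v) (at (c + t) within {0..})" "0 \<le> c" "t \<in> {0..s}"
  shows "((\<lambda>t. x (c + t)) has_vector_derivative v) (at t within {0..s})"
proof -
  have "((\<lambda>t. c + t) has_vector_derivative 1) (at t within {0..s})"
    by (auto intro!: derivative_eq_intros)
  moreover have "(x has_vector_derivative v) (at (c + t) within (\<lambda>t. c + t) ` {0..s})"
    by (rule has_vector_derivative_within_subset[OF assms(1)]) (use assms(2) in auto)
  ultimately show ?thesis
    using vector_diff_chain_within[of "\<lambda>t. c + t" 1 t "{0..s}" x v] by (simp add: o_def)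
qed

locale cycle =
  fixes V :: "'a::euclidean_space set" and Y :: "'a \<Rightarrow> 'a" and T :: real and \<gamma> :: "real \<Rightarrow> 'a"
  assumes V: "open V" and Y_lip: "lip_on_compacts V Y" and orbit: "periodic_orbit V Y T \<gamma>"
begin

definition \<Gamma> :: "'a set" where "\<Gamma> = \<gamma> ` {0..T}"

lemma T_pos: "T > 0"
  and orbit_in: "\<gamma> t \<in> V"
  and orbit_deriv: "(\<gamma> has_vector_derivative Y (\<gamma> t)) (at t)"
  and orbit_periodic: "\<gamma> (t + T) = \<gamma> t"
  using orbit by (auto simp: periodic_orbit_def)

lemma orbit_periodic_nat: "\<gamma> (t + real n * T) = \<gamma> t"
proof (induction n)
  case (Suc n)
  have "\<gamma> (t + real (Suc n) * T) = \<gamma> ((t + real n * T) + T)" by (simp add: algebra_simps)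
  then show ?case using Suc orbit_periodic by simp
qed simp

lemma orbit_mod:
  obtains s where "s \<in> {0..T}" "\<gamma> t = \<gamma> s"
proof -
  interpret periodic_fun_simple \<gamma> T by standard (rule orbit_periodic)
  define m where "m = \<lfloor>t / T\<rfloor>"
  have "of_int m \<le> t / T" "t / T \<le> of_int m + 1"
    unfolding m_def by linarith+
  then have "of_int m * T \<le> t" "t \<le> (of_int m + 1) * T"
    using T_pos by (simp_all add: pos_le_divide_eq pos_divide_le_eq)
  then have "t - of_int m * T \<in> {0..T}" by (simp add: algebra_simps)
  moreover have "\<gamma> t = \<gamma> (t - of_int m * T)" using minus_of_int[of t m] by simp
  ultimately show ?thesis by (rule that)
qed

lemma orbit_in_\<Gamma>: "\<gamma> t \<in> \<Gamma>"
  using orbit_mod[of t] unfolding \<Gamma>_def by (metis imageI)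

lemma orbit_continuous: "continuous_on S \<gamma>"
  by (intro continuous_at_imp_continuous_on ballI has_vector_derivative_continuous[OF orbit_deriv])

lemma \<Gamma>_compact: "compact \<Gamma>" and \<Gamma>_nonempty: "\<Gamma> \<noteq> {}" and \<Gamma>_subset: "\<Gamma> \<subseteq> V"
  unfolding \<Gamma>_def using T_pos orbit_in
  by (auto intro!: compact_continuous_image orbit_continuous)

lemma nearest_phase:
  obtains \<theta> where "\<theta> \<in> {0..T}" "infdist x \<Gamma> = norm (x - \<gamma> \<theta>)"
  using infdist_attains_inf[OF compact_imp_closed[OF \<Gamma>_compact] \<Gamma>_nonempty, of x]
  unfolding \<Gamma>_def by (metis dist_norm imageE)

lemma infdist_orbit_le: "infdist x \<Gamma> \<le> norm (x - \<gamma> t)"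
  using infdist_le[OF orbit_in_\<Gamma>, of x t] by (simp add: dist_norm)

lemma nearest_phase_orthogonal:
  assumes "infdist x \<Gamma> = norm (x - \<gamma> \<theta>)"
  shows "(x - \<gamma> \<theta>) \<bullet> Y (\<gamma> \<theta>) = 0"
proof -
  have d: "((\<lambda>s. x - \<gamma> s) has_derivative (\<lambda>h. - (h *\<^sub>R Y (\<gamma> \<theta>)))) (at \<theta>)"
    using orbit_deriv[of \<theta>] unfolding has_vector_derivative_def
    by (auto intro!: derivative_eq_intros)
  have "DERIV (\<lambda>s. (x - \<gamma> s) \<bullet> (x - \<gamma> s)) \<theta> :> - 2 * ((x - \<gamma> \<theta>) \<bullet> Y (\<gamma> \<theta>))"
    unfolding has_field_derivative_def
    by (rule has_derivative_eq_rhs[OF has_derivative_inner[OF d d]])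
       (auto simp: fun_eq_iff inner_commute)
  moreover have "(x - \<gamma> \<theta>) \<bullet> (x - \<gamma> \<theta>) \<le> (x - \<gamma> s) \<bullet> (x - \<gamma> s)" for s
    using infdist_orbit_le[of x s] assms by (simp add: dot_square_norm power_mono)
  ultimately have "- 2 * ((x - \<gamma> \<theta>) \<bullet> Y (\<gamma> \<theta>)) = 0"
    by (intro DERIV_local_min[of _ _ \<theta> 1]) auto
  then show ?thesis by simp
qed

lemma tubular_neighbourhood:
  obtains r where "r > 0" "{x. infdist x \<Gamma> \<le> r} \<subseteq> V"
  using compact_in_open_separated[OF \<Gamma>_nonempty \<Gamma>_compact V \<Gamma>_subset] by blast

lemma tube_compact: "r > 0 \<Longrightarrow> compact {x. infdist x \<Gamma> \<le> r}"
  by (rule compact_infdist_le[OF \<Gamma>_nonempty \<Gamma>_compact])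

text \<open>If the bound failed, points \<open>x\<^sub>n\<close> tending to \<open>\<Gamma>\<close> would have all \<open>|F\<^sub>i(x\<^sub>n)|\<close> of smaller
  order than their distance \<open>d\<^sub>n\<close> to \<open>\<Gamma>\<close>. Let \<open>\<gamma>(\<theta>\<^sub>n)\<close> be nearest to \<open>x\<^sub>n\<close>. A limit \<open>w\<close> of the
  unit vectors \<open>(x\<^sub>n - \<gamma>(\<theta>\<^sub>n)) / d\<^sub>n\<close> is orthogonal to the flow direction, because nearest
  points are feet of perpendiculars, and by the mean value theorem to all gradients; so \<open>w = 0\<close>,
  contradicting \<open>\<parallel>w\<parallel> = 1\<close>.\<close>

lemma transversal_distance_bound:
  fixes F :: "'i \<Rightarrow> 'a \<Rightarrow> real"
  assumes smooth: "\<And>i. i \<in> A \<Longrightarrow> smooth_on V (F i)"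
    and zero: "\<And>i t. i \<in> A \<Longrightarrow> F i (\<gamma> t) = 0"
    and regular: "\<And>t v. (\<And>i. i \<in> A \<Longrightarrow> v \<bullet> grad (F i) (\<gamma> t) = 0) \<Longrightarrow> v \<bullet> Y (\<gamma> t) = 0 \<Longrightarrow> v = 0"
  obtains C r where "C \<ge> 0" "r > 0"
    "\<forall>x m. infdist x \<Gamma> \<le> r \<longrightarrow> 0 \<le> m \<longrightarrow> (\<forall>i\<in>A. \<bar>F i x\<bar> \<le> m) \<longrightarrow> infdist x \<Gamma> \<le> C * m"
proof (rule ccontr)
  assume neg: "\<not> thesis"
  have "\<exists>x m. infdist x \<Gamma> \<le> 1 / real (Suc n) \<and> 0 \<le> m \<and> (\<forall>i\<in>A. \<bar>F i x\<bar> \<le> m) \<and> real (Suc n) * m <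
      infdist x \<Gamma>" for n
  proof (rule ccontr)
    assume "\<nexists>x m. infdist x \<Gamma> \<le> 1 / real (Suc n) \<and> 0 \<le> m \<and> (\<forall>i\<in>A. \<bar>F i x\<bar> \<le> m) \<and> real (Suc n)
        * m < infdist x \<Gamma>"
    then have "thesis"
      by (intro that[of "real (Suc n)" "1 / real (Suc n)"]) (auto simp: not_less)
    then show False using neg by blast
  qed
  then obtain x m where x: "\<And>n. infdist (x n) \<Gamma> \<le> 1 / real (Suc n)" and m: "\<And>n. 0 \<le> m n"
    and Fx: "\<And>n i. i \<in> A \<Longrightarrow> \<bar>F i (x n)\<bar> \<le> m n" and mx: "\<And>n. real (Suc n) * m n < infdist (x n) \<Gamma>"
    by metis
  have "\<exists>\<theta>. \<theta> \<in> {0..T} \<and> infdist (x n) \<Gamma> = norm (x n - \<gamma> \<theta>)" for n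
    using nearest_phase[of "x n"] by metis
  then obtain \<theta> where \<theta>: "\<And>n. \<theta> n \<in> {0..T}" "\<And>n. infdist (x n) \<Gamma> = norm (x n - \<gamma> (\<theta> n))"
    by metis
  define d where "d = (\<lambda>n. norm (x n - \<gamma> (\<theta> n)))"
  have d_le: "d n \<le> 1 / real (Suc n)" for n using x[of n] \<theta>(2)[of n] by (simp add: d_def)
  have d_pos: "d n > 0" for n
    using mx[of n] m[of n] \<theta>(2)[of n] unfolding d_def
    by (metis mult_nonneg_nonneg of_nat_0_le_iff order_le_less_trans)
  \<comment> \<open>Unit normal directions; they and the phases have a convergent subsequence.\<close>
  define v where "v = (\<lambda>n. (x n - \<gamma> (\<theta> n)) /\<^sub>R d n)"
  have xv: "x n - \<gamma> (\<theta> n) = d n *\<^sub>R v n" for n using d_pos[of n] by (simp add: v_def)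
  have "(\<theta> n, v n) \<in> {0..T} \<times> sphere 0 1" for n
    using \<theta>(1)[of n] d_pos[of n] by (auto simp: v_def d_def)
  moreover have "compact ({0..T} \<times> (sphere 0 1 :: 'a set))" by (intro compact_Times) auto
  ultimately obtain l \<sigma> where l: "l \<in> {0..T} \<times> sphere 0 1" and \<sigma>: "strict_mono \<sigma>"
    and lim: "((\<lambda>n. (\<theta> n, v n)) \<circ> \<sigma>) \<longlonglongrightarrow> l"
    unfolding compact_def by meson
  define \<theta>' where "\<theta>' = fst l"
  define w where "w = snd l"
  have \<theta>_lim: "(\<lambda>n. \<theta> (\<sigma> n)) \<longlonglongrightarrow> \<theta>'" and v_lim: "(\<lambda>n. v (\<sigma> n)) \<longlonglongrightarrow> w"
    using tendsto_fst[OF lim] tendsto_snd[OF lim] by (simp_all add: o_def \<theta>'_def w_def)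
  have w1: "norm w = 1" using l by (auto simp: w_def)
  have d_lim: "(\<lambda>n. d (\<sigma> n)) \<longlonglongrightarrow> 0"
  proof -
    have "d \<longlonglongrightarrow> 0"
      using d_le d_pos by (intro real_tendsto_sandwich[OF _ _ tendsto_const
          LIMSEQ_Suc[OF lim_1_over_n]])
        (auto intro: always_eventually less_imp_le)
    then show ?thesis using LIMSEQ_subseq_LIMSEQ[OF _ \<sigma>] by (simp add: o_def)
  qed
  have \<gamma>_lim: "(\<lambda>n. \<gamma> (\<theta> (\<sigma> n))) \<longlonglongrightarrow> \<gamma> \<theta>'"
    using continuous_on_tendsto_compose[OF orbit_continuous[of UNIV] \<theta>_lim] by simp
  obtain r where r: "r > 0" "{x. infdist x \<Gamma> \<le> r} \<subseteq> V" by (rule tubular_neighbourhood)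
  have Ycont: "continuous_on \<Gamma> Y"
    by (rule lip_on_compactsE[OF Y_lip \<Gamma>_compact \<Gamma>_subset]) (rule lipschitz_on_continuous_on)
  have "(\<lambda>n. v (\<sigma> n) \<bullet> Y (\<gamma> (\<theta> (\<sigma> n)))) \<longlonglongrightarrow> w \<bullet> Y (\<gamma> \<theta>')"
    by (intro tendsto_inner v_lim continuous_on_tendsto_compose[OF Ycont \<gamma>_lim] always_eventually
        allI orbit_in_\<Gamma>)
  moreover have "v n \<bullet> Y (\<gamma> (\<theta> n)) = 0" for n
    using nearest_phase_orthogonal[OF \<theta>(2), of n] d_pos[of n] by (simp add: xv)
  ultimately have wY: "w \<bullet> Y (\<gamma> \<theta>') = 0" by (simp add: LIMSEQ_const_iff)
  have wF: "w \<bullet> grad (F i) (\<gamma> \<theta>') = 0" if i: "i \<in> A" for i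
  proof -
    define S where "S = (\<lambda>n. closed_segment (\<gamma> (\<theta> n)) (x n))"
    have S_near: "norm (z - \<gamma> (\<theta> n)) \<le> d n" if "z \<in> S n" for z n
      using that segment_bound1[of z "\<gamma> (\<theta> n)" "x n"] by (simp add: S_def d_def)
    have S_V: "S n \<subseteq> V" if "d n \<le> r" for n
    proof
      fix z assume "z \<in> S n"
      then have "infdist z \<Gamma> \<le> r" using S_near infdist_orbit_le that order_trans by meson
      then show "z \<in> V" using r by auto
    qed
    have "\<exists>\<xi>. d n \<le> r \<longrightarrow> \<xi> \<in> S n \<and> F i (x n) - F i (\<gamma> (\<theta> n)) = (x n - \<gamma> (\<theta> n)) \<bullet> grad (F i) \<xi>" for n
    proof (cases "d n \<le> r")
      case True
      obtain \<xi> where "\<xi> \<in> S n" "F i (x n) - F i (\<gamma> (\<theta> n)) = (x n - \<gamma> (\<theta> n)) \<bullet> grad (F i) \<xi>"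
        unfolding S_def
        by (rule grad_mean_value[of "\<gamma> (\<theta> n)" "x n" "F i"])
           (use S_V[OF True] smooth_on_GDERIV[OF smooth[OF i]] in \<open>auto simp: S_def\<close>)
      then show ?thesis by blast
    qed simp
    then obtain \<xi> where \<xi>: "\<And>n. d n \<le> r \<Longrightarrow> \<xi> n \<in> S n"
      and eq: "\<And>n. d n \<le> r \<Longrightarrow> F i (x n) - F i (\<gamma> (\<theta> n)) = (x n - \<gamma> (\<theta> n)) \<bullet> grad (F i) (\<xi> n)"
      by metis
    have ev: "\<forall>\<^sub>F n in sequentially. d (\<sigma> n) \<le> r"
      using order_tendstoD(2)[OF d_lim r(1)] by (auto elim: eventually_mono)
    have "(\<lambda>n. \<xi> (\<sigma> n) - \<gamma> (\<theta> (\<sigma> n))) \<longlonglongrightarrow> 0"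
      by (rule Lim_null_comparison[OF _ d_lim])
          (use ev in \<open>auto elim!: eventually_mono intro: S_near \<xi>\<close>)
    from tendsto_add[OF this \<gamma>_lim] have "(\<lambda>n. \<xi> (\<sigma> n)) \<longlonglongrightarrow> \<gamma> \<theta>'" by simp
    then have "(\<lambda>n. grad (F i) (\<xi> (\<sigma> n))) \<longlonglongrightarrow> grad (F i) (\<gamma> \<theta>')"
      by (rule continuous_on_tendsto_compose[OF smooth_on_continuous_grad[OF smooth[OF i]]])
         (use orbit_in ev \<xi> S_V in \<open>auto elim!: eventually_mono\<close>)
    then have "(\<lambda>n. v (\<sigma> n) \<bullet> grad (F i) (\<xi> (\<sigma> n))) \<longlonglongrightarrow> w \<bullet> grad (F i) (\<gamma> \<theta>')"
      by (intro tendsto_inner v_lim)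
    moreover have "(\<lambda>n. v (\<sigma> n) \<bullet> grad (F i) (\<xi> (\<sigma> n))) \<longlonglongrightarrow> 0"
    proof (rule Lim_null_comparison)
      show "(\<lambda>n. 1 / real (Suc (\<sigma> n))) \<longlonglongrightarrow> 0"
        using LIMSEQ_subseq_LIMSEQ[OF LIMSEQ_Suc[OF lim_1_over_n] \<sigma>] by (simp add: o_def)
      have "norm (v n \<bullet> grad (F i) (\<xi> n)) \<le> 1 / real (Suc n)" if "d n \<le> r" for n
      proof -
        have "d n * \<bar>v n \<bullet> grad (F i) (\<xi> n)\<bar> = \<bar>F i (x n)\<bar>"
          using eq[OF that] zero[OF i] d_pos[of n] by (simp add: xv abs_mult)
        also have "\<dots> \<le> d n / real (Suc n)"
        proof -
          have "real (Suc n) * \<bar>F i (x n)\<bar> \<le> real (Suc n) * m n"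
            by (intro mult_left_mono Fx[OF i]) simp
          also have "\<dots> \<le> d n" using mx[of n] \<theta>(2)[of n] by (simp add: d_def)
          finally show ?thesis by (simp add: field_simps)
        qed
        also have "\<dots> = d n * (1 / real (Suc n))" by simp
        finally show ?thesis unfolding mult_le_cancel_left_pos[OF d_pos] real_norm_def .
      qed
      then show "\<forall>\<^sub>F n in sequentially. norm (v (\<sigma> n) \<bullet> grad (F i) (\<xi> (\<sigma> n))) \<le>
          1 / real (Suc (\<sigma> n))"
        using ev by (auto elim!: eventually_mono)
    qed
    ultimately show ?thesis by (rule LIMSEQ_unique)
  qed
  have "w = 0" by (rule regular[OF wF wY])
  then show False using w1 by simp
qed

text \<open>Multiplying by a cutoff supported near \<open>\<Gamma>\<close> gives a bounded, globally Lipschitz field,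
  whose solutions exist for all times and satisfy the continuous dependence estimate without any
  need to know in advance that they stay near \<open>\<Gamma>\<close>.\<close>

lemma cutoff_field:
  assumes "r > 0" "{x. infdist x \<Gamma> \<le> r} \<subseteq> V"
  obtains f L B where "L \<ge> 0" "L-lipschitz_on UNIV f" "\<And>x. norm (f x) \<le> B"
    "\<And>x. infdist x \<Gamma> \<le> r / 2 \<Longrightarrow> f x = Y x"
proof -
  let ?K = "{x. infdist x \<Gamma> \<le> r}"
  obtain L where L: "L \<ge> 0" "L-lipschitz_on ?K Y"
    by (rule lip_on_compactsE[OF Y_lip tube_compact[OF assms(1)] assms(2)])
  obtain B where B: "B \<ge> 0" "\<And>x. x \<in> ?K \<Longrightarrow> norm (Y x) \<le> B"
    using lipschitz_on_compact_bounded[OF L(2) tube_compact[OF assms(1)]] by blast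
  define \<psi> where "\<psi> = (\<lambda>x. max 0 (min 1 (2 - 2 / r * infdist x \<Gamma>)))"
  define f where "f = (\<lambda>x. \<psi> x *\<^sub>R Y x)"
  have \<psi>01: "0 \<le> \<psi> x" "\<psi> x \<le> 1" for x by (auto simp: \<psi>_def)
  have \<psi>_out: "\<psi> x = 0" if "x \<notin> ?K" for x
    using that assms(1) by (simp add: \<psi>_def field_simps)
  have \<psi>_in: "\<psi> x = 1" if "infdist x \<Gamma> \<le> r / 2" for x
    using that assms(1) by (simp add: \<psi>_def field_simps)
  have \<psi>_lip: "\<bar>\<psi> x - \<psi> y\<bar> \<le> 2 / r * dist x y" for x y
  proof -
    have "\<bar>\<psi> x - \<psi> y\<bar> \<le> \<bar>(2 - 2 / r * infdist x \<Gamma>) - (2 - 2 / r * infdist y \<Gamma>)\<bar>"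
      unfolding \<psi>_def by linarith
    also have "\<dots> = 2 / r * \<bar>infdist x \<Gamma> - infdist y \<Gamma>\<bar>"
    proof -
      have "(2 - 2 / r * infdist x \<Gamma>) - (2 - 2 / r * infdist y \<Gamma>) = 2 / r
          * (infdist y \<Gamma> - infdist x \<Gamma>)"
        by (simp add: algebra_simps)
      then show ?thesis using assms(1) by (simp only: abs_mult) (simp add: abs_minus_commute)
    qed
    also have "\<dots> \<le> 2 / r * dist x y"
      using infdist_triangle_abs[of x \<Gamma> y] assms(1) by (intro mult_left_mono) auto
    finally show ?thesis .
  qed
  have half: "dist (f x) (f y) \<le> (L + 2 / r * B) * dist x y" if "y \<in> ?K" for x y
  proof (cases "x \<in> ?K")
    case True
    have "f x - f y = \<psi> x *\<^sub>R (Y x - Y y) + (\<psi> x - \<psi> y) *\<^sub>R Y y" by (simp add: f_def algebra_simps)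
    then have "norm (f x - f y) \<le> \<psi> x * norm (Y x - Y y) + \<bar>\<psi> x - \<psi> y\<bar> * norm (Y y)"
      using \<psi>01 by (metis abs_of_nonneg norm_scaleR norm_triangle_ineq)
    also have "\<dots> \<le> 1 * (L * dist x y) + (2 / r * dist x y) * B"
      using \<psi>01 \<psi>_lip[of x y] B that lipschitz_onD[OF L(2) True that] L(1) assms(1)
      by (intro add_mono mult_mono) (auto simp: dist_norm)
    finally show ?thesis by (simp add: dist_norm algebra_simps)
  next
    case False
    have "norm (f x - f y) = \<bar>\<psi> x - \<psi> y\<bar> * norm (Y y)"
      using \<psi>_out[OF False] by (simp add: f_def)
    also have "\<dots> \<le> (2 / r * dist x y) * B"
      using \<psi>_lip[of x y] B that assms(1) by (intro mult_mono) auto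
    also have "\<dots> \<le> (L + 2 / r * B) * dist x y"
      using L(1) by (simp add: algebra_simps)
    finally show ?thesis by (simp add: dist_norm)
  qed
  have "(L + 2 / r * B)-lipschitz_on UNIV f"
  proof (rule lipschitz_onI)
    show nn: "0 \<le> L + 2 / r * B" using L B assms by simp
    fix x y
    consider "y \<in> ?K" | "x \<in> ?K" | "x \<notin> ?K" "y \<notin> ?K" by blast
    then show "dist (f x) (f y) \<le> (L + 2 / r * B) * dist x y"
    proof cases
      case 1 then show ?thesis by (rule half)
    next
      case 2 then show ?thesis using half[of x y] by (simp add: dist_commute)
    next
      case 3 then show ?thesis using \<psi>_out nn by (simp add: f_def)
    qed
  qed
  moreover have "norm (f x) \<le> B" for x
  proof (cases "x \<in> ?K")
    case True
    have "norm (f x) \<le> 1 * norm (Y x)" using \<psi>01[of x] mult_right_mono[of "\<psi> x" 1 "norm (Y x)"]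
        by (simp add: f_def)
    then show ?thesis using B(2)[OF True] by simp
  next
    case False then show ?thesis using \<psi>_out B by (simp add: f_def)
  qed
  moreover have "f x = Y x" if "infdist x \<Gamma> \<le> r / 2" for x using \<psi>_in[OF that] by (simp add: f_def)
  moreover have "0 \<le> L + 2 / r * B" using L B assms by simp
  ultimately show ?thesis using that by blast
qed

end

section \<open>Dissipative systems over one period\<close>

lemma common_lipschitz_constant:
  fixes g :: "'i \<Rightarrow> 'a::metric_space \<Rightarrow> 'b::metric_space"
  assumes "finite A" "\<And>i. i \<in> A \<Longrightarrow> lip_on_compacts V (g i)" "compact K" "K \<subseteq> V"
  obtains M where "M \<ge> 0" "\<And>i. i \<in> A \<Longrightarrow> M-lipschitz_on K (g i)"
proof -
  have "\<forall>i\<in>A. \<exists>M. M-lipschitz_on K (g i)"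
    using assms unfolding lip_on_compacts_def by blast
  then obtain m where m: "\<And>i. i \<in> A \<Longrightarrow> (m i)-lipschitz_on K (g i)" by metis
  have m0: "\<And>i. i \<in> A \<Longrightarrow> m i \<ge> 0" using m lipschitz_on_nonneg by blast
  show ?thesis
  proof (rule that[of "sum m A"])
    show "sum m A \<ge> 0" using m0 by (rule sum_nonneg)
    show "(sum m A)-lipschitz_on K (g i)" if "i \<in> A" for i
      by (rule lipschitz_on_mono[OF m[OF that] order_refl])
         (use member_le_sum[of i A m] that m0 assms(1) in auto)
  qed
qed

lemma has_derivative_along_curve:
  assumes "GDERIV F (x t) :> g" "(x has_vector_derivative v) (at t within S)"
  shows "((\<lambda>t. F (x t)) has_real_derivative v \<bullet> g) (at t within S)"
  using has_derivative_compose[OF assms(2)[unfolded has_vector_derivative_def]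
      assms(1)[unfolded gderiv_def]]
  by (simp add: has_field_derivative_def mult_commute_abs)

text \<open>The assumption \<open>frame\<close> makes the \<open>I\<^sub>i\<close> and \<open>D\<^sub>j\<close> local coordinates transversal to the
  cycle.\<close>

locale dissipative_cycle = cycle V Y T \<gamma>
  for V :: "(real^'n) set" and Y T \<gamma> +
  fixes k p :: nat and I D h :: "nat \<Rightarrow> real^'n \<Rightarrow> real"
  assumes dissipative: "codim_one_dissipative V Y k p I D h"
    and I_zero: "\<And>i t. i \<in> {1..k} \<Longrightarrow> I i (\<gamma> t) = 0"
    and D_zero: "\<And>j t. j \<in> {1..p} \<Longrightarrow> D j (\<gamma> t) = 0"
    and frame: "\<And>t. lin_indep_list (map (\<lambda>i. grad (I i) (\<gamma> t)) [1..<Suc k] @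
            map (\<lambda>j. grad (D j) (\<gamma> t)) [1..<Suc p] @ [Y (\<gamma> t)])"
begin

abbreviation zero_level :: "(real^'n) set" where "zero_level \<equiv> fibre V k I (\<lambda>_. 0)"

lemma kp: "k + p = CARD('n) - 1"
  and I_smooth: "\<And>i. i \<in> {1..k} \<Longrightarrow> smooth_on V (I i)"
  and D_smooth: "\<And>j. j \<in> {1..p} \<Longrightarrow> smooth_on V (D j)"
  and h_smooth: "\<And>j. j \<in> {1..p} \<Longrightarrow> smooth_on V (h j)"
  and Y_I: "\<And>i x. i \<in> {1..k} \<Longrightarrow> x \<in> V \<Longrightarrow> Y x \<bullet> grad (I i) x = 0"
  and Y_D: "\<And>j x. j \<in> {1..p} \<Longrightarrow> x \<in> V \<Longrightarrow> Y x \<bullet> grad (D j) x = h j x * D j x"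
  using dissipative by (auto simp: codim_one_dissipative_def lie_derivative_def)

lemma distance_bound:
  obtains C r where "C \<ge> 0" "r > 0" "{x. infdist x \<Gamma> \<le> r} \<subseteq> V"
    "\<forall>x\<in>zero_level. infdist x \<Gamma> \<le> r \<longrightarrow> infdist x \<Gamma> \<le> C * (\<Sum>j\<in>{1..p}. \<bar>D j x\<bar>)"
proof -
  let ?F = "append_map k I D"
  have F_D: "?F (k + j) = D j" if "j \<ge> 1" for j using that by (auto simp: append_map_def fun_eq_iff)
  have F_I: "?F i = I i" if "i \<le> k" for i using that by (auto simp: append_map_def)
  have split: "i \<in> {1..k} \<or> (\<exists>j\<in>{1..p}. i = k + j)" if "i \<in> {1..k+p}" for i
  proof (cases "i \<le> k")
    case False
    then have "i - k \<in> {1..p}" "i = k + (i - k)" using that by auto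
    then show ?thesis by blast
  qed (use that in auto)
  obtain C r where C: "C \<ge> 0" "r > 0"
    and bound: "\<forall>x m. infdist x \<Gamma> \<le> r \<longrightarrow> 0 \<le> m \<longrightarrow> (\<forall>i\<in>{1..k+p}. \<bar>?F i x\<bar> \<le> m) \<longrightarrow> infdist x \<Gamma> \<le> C * m"
  proof (rule transversal_distance_bound[of "{1..k+p}" ?F])
    show "smooth_on V (?F i)" if "i \<in> {1..k+p}" for i
      using split[OF that] I_smooth D_smooth F_I F_D by auto
    show "?F i (\<gamma> t) = 0" if "i \<in> {1..k+p}" for i t
      using split[OF that] I_zero D_zero F_I F_D by auto
    fix t v assume v: "\<And>i. i \<in> {1..k+p} \<Longrightarrow> v \<bullet> grad (?F i) (\<gamma> t) = 0" "v \<bullet> Y (\<gamma> t) = 0"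
    show "v = 0"
    proof (rule lin_indep_list_orthogonal_zero[OF frame[of t]])
      show "length (map (\<lambda>i. grad (I i) (\<gamma> t)) [1..<Suc k] @
            map (\<lambda>j. grad (D j) (\<gamma> t)) [1..<Suc p] @ [Y (\<gamma> t)]) = CARD('n)"
        using kp zero_less_card_finite[where 'a='n] by (simp del: upt_Suc)
      have "v \<bullet> grad (I i) (\<gamma> t) = 0" if "i \<in> {1..<Suc k}" for i
        using v(1)[of i] F_I[of i] that by auto
      moreover have "v \<bullet> grad (D j) (\<gamma> t) = 0" if "j \<in> {1..<Suc p}" for j
        using v(1)[of "k + j"] F_D[of j] that by auto
      ultimately show "v \<bullet> w = 0" if "w \<in> set (map (\<lambda>i. grad (I i) (\<gamma> t)) [1..<Suc k] @
            map (\<lambda>j. grad (D j) (\<gamma> t)) [1..<Suc p] @ [Y (\<gamma> t)])" for w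
        using that v(2) by (auto simp del: upt_Suc)
    qed
  qed (rule that)
  obtain r' where r': "r' > 0" "{x. infdist x \<Gamma> \<le> r'} \<subseteq> V" by (rule tubular_neighbourhood)
  show ?thesis
  proof (rule that[of C "min r r'"], safe)
    fix x assume x: "x \<in> zero_level" "infdist x \<Gamma> \<le> min r r'"
    have nn: "0 \<le> (\<Sum>j\<in>{1..p}. \<bar>D j x\<bar>)" by (intro sum_nonneg) simp
    show "infdist x \<Gamma> \<le> C * (\<Sum>j\<in>{1..p}. \<bar>D j x\<bar>)"
    proof (rule bound[rule_format])
      show "\<bar>?F i x\<bar> \<le> (\<Sum>j\<in>{1..p}. \<bar>D j x\<bar>)" if "i \<in> {1..k+p}" for i
        using split[OF that]
      proof
        assume "i \<in> {1..k}"
        then show ?thesis using x nn F_I[of i] by (simp add: fibre_def)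
      next
        assume "\<exists>j\<in>{1..p}. i = k + j"
        then obtain j where j: "j \<in> {1..p}" "i = k + j" by blast
        then show ?thesis using F_D[of j] by (auto intro: member_le_sum)
      qed
    qed (use x nn in auto)
  qed (use C r' in auto)
qed

lemma I_along:
  assumes "i \<in> {1..k}" "x t \<in> V" "(x has_vector_derivative Y (x t)) (at t within S)"
  shows "((\<lambda>t. I i (x t)) has_real_derivative 0) (at t within S)"
  using has_derivative_along_curve[where F="I i",
      OF smooth_on_GDERIV[OF I_smooth] assms(3)] Y_I assms by simp

lemma D_along:
  assumes "j \<in> {1..p}" "x t \<in> V" "(x has_vector_derivative Y (x t)) (at t within S)"
  shows "((\<lambda>t. D j (x t)) has_real_derivative h j (x t) * D j (x t)) (at t within S)"
  using has_derivative_along_curve[where F="D j",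
      OF smooth_on_GDERIV[OF D_smooth] assms(3)] Y_D assms by simp

lemma h_orbit_continuous:
  assumes "j \<in> {1..p}"
  shows "continuous_on S (\<lambda>s. h j (\<gamma> s))"
proof -
  obtain L where "L-lipschitz_on \<Gamma> (h j)"
    using lip_on_compactsE[OF smooth_on_imp_lip_on_compacts[OF h_smooth[OF assms] V] \<Gamma>_compact
        \<Gamma>_subset] by metis
  then have "continuous_on \<Gamma> (h j)" by (rule lipschitz_on_continuous_on)
  then show ?thesis
    by (rule continuous_on_compose2[OF _ orbit_continuous]) (use orbit_in_\<Gamma> in auto)
qed

text \<open>Near the orbit the coefficient \<open>h\<^sub>j(x(t))\<close> differs from \<open>h\<^sub>j(\<gamma>(\<theta> + t))\<close> by at most \<open>M \<rho>\<close>,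
  and the integral of the latter over one period does not depend on the phase \<open>\<theta>\<close>.\<close>

lemma D_over_one_period:
  assumes j: "j \<in> {1..p}" and tube: "{x. infdist x \<Gamma> \<le> r} \<subseteq> V"
    and M: "M-lipschitz_on {x. infdist x \<Gamma> \<le> r} (h j)"
    and \<theta>: "\<theta> \<in> {0..T}" and \<rho>: "\<rho> \<le> r"
    and near: "\<And>t. t \<in> {0..T} \<Longrightarrow> norm (x t - \<gamma> (\<theta> + t)) \<le> \<rho>"
    and sol: "\<And>t. t \<in> {0..T} \<Longrightarrow> (x has_vector_derivative Y (x t)) (at t within {0..T})"
  shows "\<bar>D j (x T)\<bar> \<le> exp (integral {0..T} (\<lambda>s. h j (\<gamma> s)) + M * \<rho> * T) * \<bar>D j (x 0)\<bar>"
    and "exp (integral {0..T} (\<lambda>s. h j (\<gamma> s)) - M * \<rho> * T) * \<bar>D j (x 0)\<bar> \<le> \<bar>D j (x T)\<bar>"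
proof -
  have T0: "0 \<le> T" using T_pos by simp
  have in_tube: "infdist (x t) \<Gamma> \<le> r" if "t \<in> {0..T}" for t
    using near[OF that] infdist_orbit_le[of "x t" "\<theta> + t"] \<rho> by linarith
  have orbit_tube: "infdist (\<gamma> t) \<Gamma> \<le> r" for t
    using in_tube[of 0] T0 infdist_zero[OF orbit_in_\<Gamma>[of t]] infdist_nonneg[of "x 0" \<Gamma>] by simp
  have close: "\<bar>h j (x t) - h j (\<gamma> (\<theta> + t))\<bar> \<le> M * \<rho>" if t: "t \<in> {0..T}" for t
  proof -
    have "\<bar>h j (x t) - h j (\<gamma> (\<theta> + t))\<bar> \<le> M * norm (x t - \<gamma> (\<theta> + t))"
      using lipschitz_onD[OF M, of "x t" "\<gamma> (\<theta> + t)"] in_tube[OF t] orbit_tube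
          by (simp add: dist_norm)
    also have "\<dots> \<le> M * \<rho>" using near[OF t] lipschitz_on_nonneg[OF M] by (rule mult_left_mono)
    finally show ?thesis .
  qed
  have cont: "continuous_on {0..T} (\<lambda>t. h j (\<gamma> (\<theta> + t)) + c)" for c
    by (intro continuous_intros continuous_on_compose2[OF h_orbit_continuous[OF j, of UNIV]]) auto
  have int: "integral {0..T} (\<lambda>t. h j (\<gamma> (\<theta> + t)) + c) = integral {0..T} (\<lambda>s. h j (\<gamma> s)) + c * T"
      for c
  proof -
    have "integral {0..T} (\<lambda>t. h j (\<gamma> (\<theta> + t)) + c) = integral {0..T} (\<lambda>t. h j (\<gamma> (\<theta> + t))) + c * T"
      using T0 cont[of 0] by (subst integral_add) (auto intro: integrable_continuous_real)
    also have "integral {0..T} (\<lambda>t. h j (\<gamma> (\<theta> + t))) = integral {0..T} (\<lambda>s. h j (\<gamma> s))"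
      using periodic_integral_shift[OF h_orbit_continuous[OF j], of T \<theta>] orbit_periodic \<theta> by simp
    finally show ?thesis .
  qed
  have z: "((\<lambda>t. D j (x t)) has_real_derivative h j (x t) * D j (x t)) (at t within {0..T})"
      if "t \<in> {0..T}" for t
    using D_along[OF j _ sol[OF that]] in_tube[OF that] tube by blast
  show "\<bar>D j (x T)\<bar> \<le> exp (integral {0..T} (\<lambda>s. h j (\<gamma> s)) + M * \<rho> * T) * \<bar>D j (x 0)\<bar>"
    using linear_ode_upper_bound[OF T0 cont[of "M * \<rho>"] z] close unfolding int
        by (fastforce simp: abs_le_iff)
  show "exp (integral {0..T} (\<lambda>s. h j (\<gamma> s)) - M * \<rho> * T) * \<bar>D j (x 0)\<bar> \<le> \<bar>D j (x T)\<bar>"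
    using linear_ode_lower_bound[OF T0 cont[of "- (M * \<rho>)"] z] close unfolding int
        by (fastforce simp: abs_le_iff)
qed

end

section \<open>Stability and instability of a dissipative cycle\<close>

lemma nonneg_period_decomposition:
  fixes t T :: real
  assumes "t \<ge> 0" "T > 0"
  obtains s where "s \<in> {0..T}" "t = real (nat \<lfloor>t / T\<rfloor>) * T + s"
proof -
  define n where "n = nat \<lfloor>t / T\<rfloor>"
  have "real n = of_int \<lfloor>t / T\<rfloor>" using assms by (simp add: n_def)
  then have "real n \<le> t / T" "t / T \<le> real n + 1" by linarith+
  then have "real n * T \<le> t" "t \<le> (real n + 1) * T"
    using assms(2) by (simp_all add: pos_le_divide_eq pos_divide_le_eq)
  then show ?thesis by (intro that[of "t - real n * T"]) (auto simp: n_def algebra_simps)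
qed

lemma convergent_geometric_increments:
  fixes X :: "nat \<Rightarrow> 'a::banach"
  assumes "\<And>n. norm (X (Suc n) - X n) \<le> A * q ^ n" "0 \<le> q" "q < 1"
  shows "convergent X"
proof -
  have "summable (\<lambda>n. X (Suc n) - X n)"
    by (rule summable_comparison_test'[where g = "\<lambda>n. A * q ^ n" and N = 0])
       (use assms in \<open>auto intro!: summable_mult summable_geometric\<close>)
  then have "(\<lambda>n. \<Sum>i<n. X (Suc i) - X i) \<longlonglongrightarrow> (\<Sum>n. X (Suc n) - X n)"
    by (rule summable_LIMSEQ)
  then have "(\<lambda>n. X n - X 0) \<longlonglongrightarrow> (\<Sum>n. X (Suc n) - X n)"
    by (simp add: sum_lessThan_telescope)
  from tendsto_add[OF this tendsto_const[of "X 0"]] show ?thesis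
    by (auto simp: convergent_def)
qed

lemma (in cycle) orbit_shift_deriv:
  "((\<lambda>s. \<gamma> (\<theta> + s)) has_vector_derivative Y (\<gamma> (\<theta> + s))) (at s within S)"
proof -
  have "((\<lambda>s. \<theta> + s) has_vector_derivative 1) (at s within S)"
    by (auto intro!: derivative_eq_intros)
  from vector_diff_chain_within[OF this has_vector_derivative_at_within[OF orbit_deriv[of "\<theta> + s"]]]
  show ?thesis by (simp add: o_def)
qed

context dissipative_cycle
begin

text \<open>The induction over periods keeps three facts: the sample \<open>X n\<close> is within \<open>\<rho>\<^sub>1\<close> of \<open>\<Gamma>\<close>, so
  that the solution stays within \<open>\<rho>\<close> for the next period; it lies on \<open>I = 0\<close>, so that \<open>N\<close>, the
  sum of the \<open>|D\<^sub>j|\<close>, controls its distance to \<open>\<Gamma>\<close>; and \<open>N\<close> has shrunk by the factor \<open>q\<^sup>n\<close>. The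
  last two give the first one for the next sample.\<close>

lemma attraction:
  assumes neg: "\<And>j. j \<in> {1..p} \<Longrightarrow> integral {0..T} (\<lambda>s. h j (\<gamma> s)) < 0"
  obtains \<delta> A where "\<delta> > 0" "A \<ge> 0"
    "\<forall>x0\<in>zero_level. infdist x0 \<Gamma> < \<delta> \<longrightarrow>
      (\<exists>x. forward_solution V Y x0 x \<and> (\<forall>t\<ge>0. infdist (x t) \<Gamma> \<le> A * infdist x0 \<Gamma>) \<and>
        (\<exists>\<theta>. ((\<lambda>t. norm (x t - \<gamma> (t + \<theta>))) \<longlongrightarrow> 0) at_top))"
proof -
  obtain C r where C: "C \<ge> 0" and r: "r > 0" "{x. infdist x \<Gamma> \<le> r} \<subseteq> V"
    and dist_le: "\<forall>x\<in>zero_level. infdist x \<Gamma> \<le> r \<longrightarrow> infdist x \<Gamma> \<le> C * (\<Sum>j\<in>{1..p}. \<bar>D j x\<bar>)"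
    by (rule distance_bound)
  define K where "K = {x. infdist x \<Gamma> \<le> r}"
  have K: "compact K" "K \<subseteq> V" using r tube_compact by (auto simp: K_def)
  obtain f L B where L: "L \<ge> 0" "L-lipschitz_on UNIV f" and B: "\<And>x. norm (f x) \<le> B"
    and fY: "\<And>x. infdist x \<Gamma> \<le> r / 2 \<Longrightarrow> f x = Y x"
    using cutoff_field[OF r] by metis
  obtain M where M: "M \<ge> 0" "\<And>j. j \<in> {1..p} \<Longrightarrow> M-lipschitz_on K (h j)"
    using common_lipschitz_constant[OF _ smooth_on_imp_lip_on_compacts[OF h_smooth V] K,
        of "{1..p}" "\<lambda>j. j"] by auto
  obtain M' where M': "M' \<ge> 0" "\<And>j. j \<in> {1..p} \<Longrightarrow> M'-lipschitz_on K (D j)"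
    using common_lipschitz_constant[OF _ smooth_on_imp_lip_on_compacts[OF D_smooth V] K,
        of "{1..p}" "\<lambda>j. j"] by auto
  define N where "N = (\<lambda>x. \<Sum>j\<in>{1..p}. \<bar>D j x\<bar>)"
  \<comment> \<open>The \<open>1\<close> keeps the minimum meaningful when \<open>p = 0\<close>. Halving leaves room
      for the error term \<open>M \<rho> T \<le> c\<close>.\<close>
  define c where "c = Min (insert 1 ((\<lambda>j. - integral {0..T} (\<lambda>s. h j (\<gamma> s))) ` {1..p})) / 2"
  have c: "c > 0" using neg by (auto simp: c_def)
  have c_le: "integral {0..T} (\<lambda>s. h j (\<gamma> s)) \<le> - (2 * c)" if "j \<in> {1..p}" for j
  proof -
    have "Min (insert 1 ((\<lambda>j. - integral {0..T} (\<lambda>s. h j (\<gamma> s))) ` {1..p})) \<le>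
        - integral {0..T} (\<lambda>s. h j (\<gamma> s))"
      using that by (intro Min_le) auto
    then show ?thesis unfolding c_def by linarith
  qed
  define E where "E = exp (L * T)"
  have E: "E \<ge> 1" using L T_pos by (simp add: E_def)
  define \<rho> where "\<rho> = min (r / 2) (c / (M * T + 1))"
  have MT: "M * T \<ge> 0" using M T_pos by simp
  have \<rho>: "\<rho> > 0" "\<rho> \<le> r / 2" "M * \<rho> * T \<le> c"
  proof -
    show "\<rho> > 0" using r c MT by (simp add: \<rho>_def)
    show "\<rho> \<le> r / 2" unfolding \<rho>_def by (rule min.cobounded1)
    have "M * T * \<rho> \<le> (M * T + 1) * (c / (M * T + 1))"
      using MT \<open>\<rho> > 0\<close> by (intro mult_mono) (auto simp: \<rho>_def)
    also have "\<dots> = c" using MT by simp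
    finally show "M * \<rho> * T \<le> c" by (simp add: mult_ac)
  qed
  \<comment> \<open>One period magnifies the distance to the orbit at most by \<open>E\<close>.\<close>
  define \<rho>\<^sub>1 where "\<rho>\<^sub>1 = \<rho> / E"
  have \<rho>\<^sub>1: "\<rho>\<^sub>1 > 0" "E * \<rho>\<^sub>1 = \<rho>" "\<rho>\<^sub>1 \<le> \<rho>" using \<rho> E by (auto simp: \<rho>\<^sub>1_def field_simps)
  define P where "P = C * (real p * M')"
  have P: "P \<ge> 0" using C M' by (simp add: P_def)
  \<comment> \<open>The sum \<open>N\<close> is at most a multiple of the distance, so \<open>C N\<close> starts, and hence stays,
      below \<open>\<rho>\<^sub>1\<close>.\<close>
  define \<delta> where "\<delta> = \<rho>\<^sub>1 / (P + 1)"
  have \<delta>: "\<delta> > 0" "\<delta> \<le> \<rho>\<^sub>1" "P * \<delta> \<le> \<rho>\<^sub>1" using \<rho>\<^sub>1 P by (auto simp: \<delta>_def field_simps)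
  define q where "q = exp (- c)"
  have q: "0 < q" "q < 1" using c by (auto simp: q_def)
  have N_le: "C * N x \<le> P * infdist x \<Gamma>" if "infdist x \<Gamma> \<le> r" for x
  proof -
    obtain \<theta> where \<theta>: "infdist x \<Gamma> = norm (x - \<gamma> \<theta>)" by (rule nearest_phase)
    have "\<bar>D j x\<bar> \<le> M' * infdist x \<Gamma>" if j: "j \<in> {1..p}" for j
      using lipschitz_onD[OF M'(2)[OF j], of x "\<gamma> \<theta>"] D_zero[OF j] that \<open>infdist x \<Gamma> \<le> r\<close> r(1)
        infdist_zero[OF orbit_in_\<Gamma>, of \<theta>] \<theta> by (simp add: K_def dist_norm)
    then have "N x \<le> (\<Sum>j\<in>{1..p}. M' * infdist x \<Gamma>)" unfolding N_def by (rule sum_mono)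
    then have "C * N x \<le> C * (real p * (M' * infdist x \<Gamma>))" using C by (intro mult_left_mono) auto
    then show ?thesis by (simp add: P_def mult_ac)
  qed
  have main: "\<exists>x. forward_solution V Y x0 x \<and> (\<forall>t\<ge>0. infdist (x t) \<Gamma> \<le> (E * P) * infdist x0 \<Gamma>) \<and>
        (\<exists>\<theta>. ((\<lambda>t. norm (x t - \<gamma> (t + \<theta>))) \<longlongrightarrow> 0) at_top)"
    if x0: "x0 \<in> zero_level" "infdist x0 \<Gamma> < \<delta>" for x0
  proof -
    obtain x where x0_eq: "x 0 = x0" and x: "\<And>t. t \<ge> 0 \<Longrightarrow>
        (x has_vector_derivative f (x t)) (at t within {0..})"
      using lipschitz_ode_global_solution[OF L(2) B] by blast
    define X where "X = (\<lambda>n::nat. x (real n * T))"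
    have X_Suc: "X (Suc n) = x (real n * T + T)" for n by (simp add: X_def algebra_simps)
    have window: "((\<lambda>s. x (real n * T + s)) has_vector_derivative f (x (real n * T
        + s))) (at s within {0..\<tau>})"
      if "s \<in> {0..\<tau>}" for n s \<tau>
      using that T_pos by (intro has_vector_derivative_window x) auto
    have orbit_window: "((\<lambda>s. \<gamma> (\<theta> + s)) has_vector_derivative f (\<gamma> (\<theta>
        + s))) (at s within {0..\<tau>})" for \<theta> s \<tau>
      using orbit_shift_deriv[of \<theta> s] fY[of "\<gamma> (\<theta> + s)"] infdist_zero[OF orbit_in_\<Gamma>] r by simp
    have track: "norm (x (real n * T + s) - \<gamma> (\<theta> + s)) \<le> E * norm (X n - \<gamma> \<theta>)" if s: "s \<in> {0..T}"
        for n s \<theta>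
    proof -
      have "norm (x (real n * T + s) - \<gamma> (\<theta> + s)) \<le> exp (L * s)
          * norm (x (real n * T + 0) - \<gamma> (\<theta> + 0))"
        by (rule lipschitz_ode_continuous_dependence[OF L(2), of s "\<lambda>s. x (real n * T + s)" "\<lambda>s.
            \<gamma> (\<theta> + s)"])
           (use s window orbit_window in auto)
      also have "\<dots> \<le> E * norm (X n - \<gamma> \<theta>)"
        using s L by (auto simp: E_def X_def intro!: mult_right_mono mult_left_mono)
      finally show ?thesis .
    qed
    have near: "infdist (x (real n * T + s)) \<Gamma> \<le> E * infdist (X n) \<Gamma>" if "s \<in> {0..T}" for n s
    proof -
      obtain \<theta> where "infdist (X n) \<Gamma> = norm (X n - \<gamma> \<theta>)" by (rule nearest_phase)
      then show ?thesis using track[OF that, of n \<theta>] infdist_orbit_le[of "x (real n * T + s)" "\<theta>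
          + s"] by simp
    qed
    have N0: "C * N x0 \<le> P * infdist x0 \<Gamma>" using x0 \<delta> \<rho>\<^sub>1 \<rho> r by (intro N_le) linarith
    have inv: "infdist (X n) \<Gamma> \<le> \<rho>\<^sub>1 \<and> X n \<in> zero_level \<and> N (X n) \<le> q ^ n * N x0" for n
    proof (induction n)
      case 0
      then show ?case using x0 \<delta> by (simp add: X_def x0_eq)
    next
      case (Suc n)
      then have n: "infdist (X n) \<Gamma> \<le> \<rho>\<^sub>1" "X n \<in> zero_level" "N (X n) \<le> q ^ n * N x0" by auto
      obtain \<theta> where \<theta>: "\<theta> \<in> {0..T}" "infdist (X n) \<Gamma> = norm (X n - \<gamma> \<theta>)" by (rule nearest_phase)
      have tr: "norm (x (real n * T + s) - \<gamma> (\<theta> + s)) \<le> \<rho>" if "s \<in> {0..T}" for s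
      proof -
        have "E * norm (X n - \<gamma> \<theta>) \<le> E * \<rho>\<^sub>1" using n \<theta> E by (intro mult_left_mono) auto
        then show ?thesis using track[OF that, of n \<theta>] \<rho>\<^sub>1 by linarith
      qed
      have tube: "infdist (x (real n * T + s)) \<Gamma> \<le> \<rho>" if "s \<in> {0..T}" for s
        using tr[OF that] infdist_orbit_le order_trans by blast
      have tubeV: "x (real n * T + s) \<in> V" if "s \<in> {0..T}" for s
        using tube[OF that] \<rho> r by auto
      have sol: "((\<lambda>s. x (real n * T + s)) has_vector_derivative Y (x (real n * T
          + s))) (at s within {0..T})"
        if s: "s \<in> {0..T}" for s
        using window[OF s, of n] fY[of "x (real n * T + s)"] tube[OF s] \<rho> by simp
      have T0: "T \<in> {0..T}" "0 \<le> T" using T_pos by auto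
      have "I i (X (Suc n)) = 0" if i: "i \<in> {1..k}" for i
      proof -
        have "\<bar>I i (x (real n * T + T))\<bar> \<le> exp (integral {0..T} (\<lambda>_. 0))
            * \<bar>I i (x (real n * T + 0))\<bar>"
          by (rule linear_ode_upper_bound[where a = "\<lambda>_. 0"])
             (use T0 I_along[OF i tubeV sol] in auto)
        then show ?thesis using n(2) i unfolding X_Suc by (simp add: X_def fibre_def)
      qed
      then have level: "X (Suc n) \<in> zero_level" using tubeV[OF T0(1)] by (simp add: fibre_def X_Suc)
      have "\<bar>D j (X (Suc n))\<bar> \<le> q * \<bar>D j (X n)\<bar>" if j: "j \<in> {1..p}" for j
      proof -
        have "\<bar>D j (x (real n * T + T))\<bar> \<le> exp (integral {0..T} (\<lambda>s. h j (\<gamma> s)) + M * \<rho> * T)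
            * \<bar>D j (x (real n * T + 0))\<bar>"
          by (rule D_over_one_period(1)[OF j r(2) M(2)[OF j, unfolded K_def] \<theta>(1) _ tr sol])
             (use \<rho> r in auto)
        also have "\<dots> \<le> q * \<bar>D j (x (real n * T + 0))\<bar>"
          using c_le[OF j] \<rho>(3) by (intro mult_right_mono) (auto simp: q_def)
        finally show ?thesis unfolding X_Suc by (simp add: X_def)
      qed
      then have "N (X (Suc n)) \<le> q * N (X n)"
        unfolding N_def sum_distrib_left by (rule sum_mono)
      also have "\<dots> \<le> q * (q ^ n * N x0)" using n(3) q by (intro mult_left_mono) auto
      finally have NS: "N (X (Suc n)) \<le> q ^ Suc n * N x0" by simp
      have "N x0 \<ge> 0" unfolding N_def by (intro sum_nonneg) simp
      then have "q ^ Suc n * N x0 \<le> 1 * N x0"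
        using q by (intro mult_right_mono power_le_one) auto
      then have "C * N (X (Suc n)) \<le> C * N x0" using NS C by (intro mult_left_mono) auto
      moreover have "infdist (X (Suc n)) \<Gamma> \<le> C * N (X (Suc n))"
        unfolding N_def using dist_le level tube[OF T0(1)] \<rho> r by (simp add: X_Suc)
      moreover have "P * infdist x0 \<Gamma> \<le> P * \<delta>" using x0 P by (intro mult_left_mono) auto
      ultimately have "infdist (X (Suc n)) \<Gamma> \<le> \<rho>\<^sub>1" using N0 \<delta> by linarith
      then show ?case using level NS by blast
    qed
    have decay: "infdist (X n) \<Gamma> \<le> P * infdist x0 \<Gamma> * q ^ n" for n
    proof -
      have "infdist (X n) \<Gamma> \<le> C * N (X n)" unfolding N_def
        using inv[of n] \<rho>\<^sub>1 \<rho> r by (intro dist_le[rule_format]) auto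
      also have "\<dots> \<le> C * (q ^ n * N x0)" using inv[of n] C by (intro mult_left_mono) auto
      also have "\<dots> = q ^ n * (C * N x0)" by simp
      also have "\<dots> \<le> q ^ n * (P * infdist x0 \<Gamma>)" using N0 q by (intro mult_left_mono) auto
      finally show ?thesis by (simp add: mult_ac)
    qed
    have tube: "infdist (x t) \<Gamma> \<le> \<rho>" "infdist (x t) \<Gamma> \<le> (E * P) * infdist x0 \<Gamma>" if "t \<ge> 0" for t
    proof -
      obtain s where s: "s \<in> {0..T}" "t = real (nat \<lfloor>t / T\<rfloor>) * T + s"
        by (rule nonneg_period_decomposition[OF \<open>t \<ge> 0\<close> T_pos])
      define n where "n = nat \<lfloor>t / T\<rfloor>"
      have 1: "infdist (x t) \<Gamma> \<le> E * infdist (X n) \<Gamma>"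
        using near[OF s(1), of n] s(2) by (simp add: n_def)
      have "E * infdist (X n) \<Gamma> \<le> E * \<rho>\<^sub>1" using inv[of n] E by (intro mult_left_mono) auto
      then show "infdist (x t) \<Gamma> \<le> \<rho>" using 1 \<rho>\<^sub>1 by linarith
      have "P * infdist x0 \<Gamma> * q ^ n \<le> P * infdist x0 \<Gamma> * 1"
        using q by (intro mult_left_mono power_le_one mult_nonneg_nonneg P infdist_nonneg) auto
      then have "E * infdist (X n) \<Gamma> \<le> E * (P * infdist x0 \<Gamma>)" using decay[of n] E
          by (intro mult_left_mono) auto
      then show "infdist (x t) \<Gamma> \<le> (E * P) * infdist x0 \<Gamma>" using 1 by (simp add: mult_ac)
    qed
    have "forward_solution V Y x0 x"
      unfolding forward_solution_def
    proof (intro conjI allI impI x0_eq)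
      fix t :: real assume t: "0 \<le> t"
      have "infdist (x t) \<Gamma> \<le> r / 2" using tube(1)[OF t] \<rho> by linarith
      then show "x t \<in> V" "(x has_vector_derivative Y (x t)) (at t within {0..})"
        using x[OF t] fY[of "x t"] r by auto
    qed
    moreover have "\<exists>\<theta>. ((\<lambda>t. norm (x t - \<gamma> (t + \<theta>))) \<longlongrightarrow> 0) at_top"
    proof -
      \<comment> \<open>Compare both samples with the point of the orbit nearest to the first one.\<close>
      have "norm (X (Suc n) - X n) \<le> ((E + 1) * (P * infdist x0 \<Gamma>)) * q ^ n" for n
      proof -
        obtain \<theta> where \<theta>: "infdist (X n) \<Gamma> = norm (X n - \<gamma> \<theta>)" by (rule nearest_phase)
        have "norm (X (Suc n) - \<gamma> \<theta>) \<le> E * norm (X n - \<gamma> \<theta>)"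
          using track[of T n \<theta>] T_pos orbit_periodic[of \<theta>] by (simp add: X_Suc)
        then have "norm (X (Suc n) - X n) \<le> (E + 1) * infdist (X n) \<Gamma>"
          using norm_triangle_ineq4[of "X (Suc n) - \<gamma> \<theta>" "X n - \<gamma> \<theta>"] \<theta> by (simp add: algebra_simps)
        also have "\<dots> \<le> (E + 1) * (P * infdist x0 \<Gamma> * q ^ n)"
          using decay[of n] E by (intro mult_left_mono) auto
        finally show ?thesis by (simp add: mult_ac)
      qed
      then have "convergent X" using q by (intro convergent_geometric_increments) auto
      then obtain z where z: "X \<longlonglongrightarrow> z" by (auto simp: convergent_def)
      have "(\<lambda>n. P * infdist x0 \<Gamma> * q ^ n) \<longlonglongrightarrow> 0"
        using q by (intro tendsto_mult_right_zero LIMSEQ_power_zero) auto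
      then have "(\<lambda>n. infdist (X n) \<Gamma>) \<longlonglongrightarrow> 0"
        by (rule Lim_null_comparison[rotated]) (simp add: infdist_nonneg decay)
      then have "infdist z \<Gamma> = 0" using tendsto_infdist[OF z] LIMSEQ_unique by blast
      then have "z \<in> \<Gamma>"
        using in_closed_iff_infdist_zero[OF compact_imp_closed[OF \<Gamma>_compact] \<Gamma>_nonempty] by blast
      then obtain \<theta> where \<theta>: "z = \<gamma> \<theta>" by (auto simp: \<Gamma>_def)
      have lim: "(\<lambda>n. E * norm (X n - \<gamma> \<theta>)) \<longlonglongrightarrow> 0"
        using z unfolding \<theta> by (intro tendsto_mult_right_zero tendsto_norm_zero)
            (simp add: LIM_zero)
      have floor_lim: "filterlim (\<lambda>t. nat \<lfloor>t / T\<rfloor>) sequentially at_top"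
        using T_pos
        by (intro filterlim_compose[OF filterlim_nat_sequentially]
            filterlim_compose[OF filterlim_floor_sequentially]
             filterlim_at_top_mult_tendsto_pos[OF tendsto_const _ filterlim_ident, of "inverse T",
                 simplified divide_inverse[symmetric]]) auto
      have "((\<lambda>t. norm (x t - \<gamma> (t + \<theta>))) \<longlongrightarrow> 0) at_top"
      proof (rule Lim_null_comparison[OF _ filterlim_compose[OF lim floor_lim]])
        show "\<forall>\<^sub>F t in at_top. norm (norm (x t - \<gamma> (t + \<theta>))) \<le> E * norm (X (nat \<lfloor>t / T\<rfloor>) - \<gamma> \<theta>)"
          using eventually_ge_at_top[of 0]
        proof eventually_elim
          fix t :: real assume t: "t \<ge> 0"
          obtain s where s: "s \<in> {0..T}" "t = real (nat \<lfloor>t / T\<rfloor>) * T + s"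
            by (rule nonneg_period_decomposition[OF t T_pos])
          define n where "n = nat \<lfloor>t / T\<rfloor>"
          have "\<gamma> (t + \<theta>) = \<gamma> (\<theta> + s)"
            using orbit_periodic_nat[of "\<theta> + s" n] s(2) by (simp add: n_def algebra_simps)
          then show "norm (norm (x t - \<gamma> (t + \<theta>))) \<le> E * norm (X (nat \<lfloor>t / T\<rfloor>) - \<gamma> \<theta>)"
            using track[OF s(1), of n \<theta>] s(2) by (simp add: n_def)
        qed
      qed
      then show ?thesis by blast
    qed
    ultimately show ?thesis using tube(2) by blast
  qed
  show ?thesis by (rule that[OF \<delta>(1), of "E * P"]) (use E P main in auto)
qed

theorem phase_asymptotically_stable:
  assumes "\<And>j. j \<in> {1..p} \<Longrightarrow> integral {0..T} (\<lambda>s. h j (\<gamma> s)) < 0"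
  shows "orbitally_phase_asymptotically_stable V Y zero_level T \<gamma>"
proof -
  obtain \<delta> A where \<delta>: "\<delta> > 0" and A: "A \<ge> 0"
    and attr: "\<forall>x0\<in>zero_level. infdist x0 \<Gamma> < \<delta> \<longrightarrow>
      (\<exists>x. forward_solution V Y x0 x \<and> (\<forall>t\<ge>0. infdist (x t) \<Gamma> \<le> A * infdist x0 \<Gamma>) \<and>
        (\<exists>\<theta>. ((\<lambda>t. norm (x t - \<gamma> (t + \<theta>))) \<longlongrightarrow> 0) at_top))"
    by (rule attraction[OF assms])
  have "orbitally_stable V Y zero_level \<Gamma>"
    unfolding orbitally_stable_def
  proof (intro allI impI)
    fix \<epsilon> :: real assume \<epsilon>: "\<epsilon> > 0"
    show "\<exists>\<delta>>0. \<forall>x0\<in>zero_level. infdist x0 \<Gamma> < \<delta> \<longrightarrow>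
      (\<exists>x. forward_solution V Y x0 x \<and> (\<forall>t>0. infdist (x t) \<Gamma> < \<epsilon>))"
    proof (intro exI[of _ "min \<delta> (\<epsilon> / (A + 1))"] conjI ballI impI)
      show "0 < min \<delta> (\<epsilon> / (A + 1))" using \<delta> \<epsilon> A by simp
      fix x0 assume x0: "x0 \<in> zero_level" "infdist x0 \<Gamma> < min \<delta> (\<epsilon> / (A + 1))"
      then obtain x where x: "forward_solution V Y x0 x" "\<forall>t\<ge>0. infdist (x t) \<Gamma> \<le> A * infdist x0 \<Gamma>"
        using attr by force
      have "(A + 1) * infdist x0 \<Gamma> < \<epsilon>" using x0 A by (simp add: field_simps)
      moreover have "A * infdist x0 \<Gamma> \<le> (A + 1) * infdist x0 \<Gamma>"
        by (intro mult_right_mono infdist_nonneg) simp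
      ultimately have "\<forall>t>0. infdist (x t) \<Gamma> < \<epsilon>" using x(2)
          by (meson less_imp_le order_le_less_trans)
      then show "\<exists>x. forward_solution V Y x0 x \<and> (\<forall>t>0. infdist (x t) \<Gamma> < \<epsilon>)" using x(1) by blast
    qed
  qed
  moreover have "((\<lambda>t. infdist (x t) \<Gamma>) \<longlongrightarrow> 0) at_top"
    if "((\<lambda>t. norm (x t - \<gamma> (t + \<theta>))) \<longlongrightarrow> 0) at_top" for x \<theta>
    by (rule Lim_null_comparison[OF _ that]) (simp add: infdist_nonneg infdist_orbit_le)
  ultimately show ?thesis
    unfolding orbitally_phase_asymptotically_stable_def orbitally_asymptotically_stable_def
        \<Gamma>_def[symmetric]
    using \<delta> attr by (intro conjI exI[of _ \<delta>]) blast+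
qed

text \<open>The gradient of \<open>D\<^sub>j\<close> on the orbit is part of a basis, so \<open>D\<^sub>j\<close> is not locally zero
  there.\<close>

lemma nonvanishing_nearby:
  assumes j: "j \<in> {1..p}" and "e > 0"
  obtains x where "x \<in> V" "infdist x \<Gamma> < e" "D j x \<noteq> 0"
proof (rule ccontr)
  assume neg: "\<not> thesis"
  note witness = that
  have "D j x = 0" if "x \<in> V \<inter> ball (\<gamma> 0) e" for x
  proof (rule ccontr)
    assume "D j x \<noteq> 0"
    moreover have "infdist x \<Gamma> < e"
      using infdist_orbit_le[of x 0] that by (simp add: dist_norm norm_minus_commute)
    ultimately show False using neg witness[of x] that by blast
  qed
  moreover have "open (V \<inter> ball (\<gamma> 0) e)" "\<gamma> 0 \<in> V \<inter> ball (\<gamma> 0) e"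
    using V orbit_in assms(2) by auto
  ultimately have "(D j has_derivative (\<lambda>_. 0)) (at (\<gamma> 0))"
    by (intro has_derivative_transform_within_open[OF has_derivative_const[of 0]]) auto
  moreover have "(D j has_derivative (\<lambda>v. v \<bullet> grad (D j) (\<gamma> 0))) (at (\<gamma> 0))"
    using smooth_on_GDERIV[OF D_smooth[OF j] orbit_in[of 0]] by (simp add: gderiv_def)
  ultimately have "(\<lambda>_. 0) = (\<lambda>v. v \<bullet> grad (D j) (\<gamma> 0))" by (rule has_derivative_unique)
  then have "grad (D j) (\<gamma> 0) = 0" by (metis inner_eq_zero_iff)
  moreover have "grad (D j) (\<gamma> 0) \<in> set (map (\<lambda>i. grad (I i) (\<gamma> 0)) [1..<Suc k] @
            map (\<lambda>j. grad (D j) (\<gamma> 0)) [1..<Suc p] @ [Y (\<gamma> 0)])"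
    using j by (auto simp del: upt_Suc)
  ultimately show False
    using frame[of 0] dependent_zero unfolding lin_indep_list_def by metis
qed

text \<open>A solution that stays in a small enough tube follows the orbit for each single period,
  with a new phase at the start of every period, so \<open>|D\<^sub>j|\<close> gains at least the factor \<open>exp c\<close>
  each time.\<close>

theorem cycle_unstable:
  assumes j: "j \<in> {1..p}" and pos: "integral {0..T} (\<lambda>s. h j (\<gamma> s)) > 0"
  shows "unstable V Y \<Gamma>"
  unfolding unstable_def
proof
  assume stable: "orbitally_stable V Y V \<Gamma>"
  obtain r where r: "r > 0" "{x. infdist x \<Gamma> \<le> r} \<subseteq> V" by (rule tubular_neighbourhood)
  define K where "K = {x. infdist x \<Gamma> \<le> r}"
  have K: "compact K" "K \<subseteq> V" using r tube_compact by (auto simp: K_def)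
  obtain L where L: "L \<ge> 0" "L-lipschitz_on K Y" by (rule lip_on_compactsE[OF Y_lip K])
  obtain M where M: "M \<ge> 0" "M-lipschitz_on K (h j)"
    by (rule lip_on_compactsE[OF smooth_on_imp_lip_on_compacts[OF h_smooth[OF j] V] K])
  obtain M' where M': "M'-lipschitz_on K (D j)"
    by (rule lip_on_compactsE[OF smooth_on_imp_lip_on_compacts[OF D_smooth[OF j] V] K])
  obtain B where B: "\<And>x. x \<in> K \<Longrightarrow> norm (D j x) \<le> B"
    using lipschitz_on_compact_bounded[OF M' K(1)] by blast
  define c where "c = integral {0..T} (\<lambda>s. h j (\<gamma> s)) / 2"
  have c: "c > 0" using pos by (simp add: c_def)
  define E where "E = exp (L * T)"
  have E: "E \<ge> 1" using L T_pos by (simp add: E_def)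
  have MT: "M * T \<ge> 0" using M T_pos by simp
  define \<rho> where "\<rho> = min r (c / (M * T + 1))"
  have \<rho>: "\<rho> > 0" "\<rho> \<le> r" "M * \<rho> * T \<le> c"
  proof -
    show "\<rho> > 0" "\<rho> \<le> r" using r c MT by (auto simp: \<rho>_def)
    have "M * T * \<rho> \<le> (M * T + 1) * (c / (M * T + 1))"
      using MT \<open>\<rho> > 0\<close> by (intro mult_mono) (auto simp: \<rho>_def)
    also have "\<dots> = c" using MT by simp
    finally show "M * \<rho> * T \<le> c" by (simp add: mult_ac)
  qed
  define \<epsilon> where "\<epsilon> = \<rho> / E"
  have \<epsilon>: "\<epsilon> > 0" "E * \<epsilon> = \<rho>" "\<epsilon> \<le> \<rho>" using \<rho> E by (auto simp: \<epsilon>_def field_simps)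
  from stable[unfolded orbitally_stable_def, rule_format, OF \<epsilon>(1)]
  obtain \<delta> where \<delta>: "\<delta> > 0" and stab: "\<forall>x0\<in>V. infdist x0 \<Gamma> < \<delta> \<longrightarrow>
        (\<exists>x. forward_solution V Y x0 x \<and> (\<forall>t>0. infdist (x t) \<Gamma> < \<epsilon>))" by (elim exE conjE)
  have "min \<delta> \<epsilon> > 0" using \<delta> \<epsilon> by simp
  then obtain x0 where x0: "x0 \<in> V" "infdist x0 \<Gamma> < min \<delta> \<epsilon>" "D j x0 \<noteq> 0"
    by (rule nonvanishing_nearby[OF j])
  have "infdist x0 \<Gamma> < \<delta>" using x0(2) by simp
  with stab x0(1) obtain x where x: "forward_solution V Y x0 x" and "\<forall>t>0. infdist (x t) \<Gamma> < \<epsilon>"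
    by blast
  then have tube: "infdist (x t) \<Gamma> < \<epsilon>" if "t \<ge> 0" for t
    using that x0(2) by (cases "t = 0") (auto simp: forward_solution_def)
  have sol: "(x has_vector_derivative Y (x t)) (at t within {0..})" if "t \<ge> 0" for t
    using x that by (simp add: forward_solution_def)
  have window: "((\<lambda>s. x (real n * T + s)) has_vector_derivative Y (x (real n * T
      + s))) (at s within {0..\<tau>})"
    if "s \<in> {0..\<tau>}" for n s \<tau>
    using that T_pos by (intro has_vector_derivative_window sol) auto
  define X where "X = (\<lambda>n::nat. x (real n * T))"
  have grow: "exp c * \<bar>D j (X n)\<bar> \<le> \<bar>D j (X (Suc n))\<bar>" for n
  proof -
    obtain \<theta> where \<theta>: "\<theta> \<in> {0..T}" "infdist (X n) \<Gamma> = norm (X n - \<gamma> \<theta>)" by (rule nearest_phase)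
    have "infdist (X n) \<Gamma> < \<epsilon>" unfolding X_def using T_pos by (intro tube) simp
    have near: "norm (x (real n * T + s) - \<gamma> (\<theta> + s)) \<le> \<rho>" if s: "s \<in> {0..T}" for s
    proof -
      have "norm (x (real n * T + s) - \<gamma> (\<theta> + s)) \<le> exp (L * s)
          * norm (x (real n * T + 0) - \<gamma> (\<theta> + 0))"
      proof (rule lipschitz_ode_continuous_dependence[OF L(2), of s "\<lambda>s. x (real n * T + s)" "\<lambda>s.
          \<gamma> (\<theta> + s)"])
        fix t assume t: "t \<in> {0..s}"
        have "infdist (x (real n * T + t)) \<Gamma> < \<epsilon>" using t T_pos by (intro tube) auto
        then show "x (real n * T + t) \<in> K \<and> ((\<lambda>s.
            x (real n * T + s)) has_vector_derivative Y (x (real n * T + t))) (at t within {0..s})"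
          using window[OF t] \<epsilon> \<rho> by (auto simp: K_def)
        show "\<gamma> (\<theta> + t) \<in> K \<and> ((\<lambda>s. \<gamma> (\<theta> + s)) has_vector_derivative Y (\<gamma> (\<theta>
            + t))) (at t within {0..s})"
          using orbit_shift_deriv infdist_zero[OF orbit_in_\<Gamma>] r by (auto simp: K_def)
      qed (use s in auto)
      also have "\<dots> \<le> E * norm (X n - \<gamma> \<theta>)"
        using s L by (auto simp: E_def X_def intro!: mult_right_mono mult_left_mono)
      also have "\<dots> \<le> E * \<epsilon>" using \<theta> \<open>infdist (X n) \<Gamma> < \<epsilon>\<close> E by (intro mult_left_mono) auto
      finally show ?thesis using \<epsilon> by simp
    qed
    have "exp c * \<bar>D j (x (real n * T + 0))\<bar> \<le> exp (integral {0..T} (\<lambda>s. h j (\<gamma> s)) - M * \<rho> * T)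
        * \<bar>D j (x (real n * T + 0))\<bar>"
      using \<rho>(3) by (intro mult_right_mono) (auto simp: c_def)
    also have "\<dots> \<le> \<bar>D j (x (real n * T + T))\<bar>"
      by (rule D_over_one_period(2)[OF j r(2) M(2)[unfolded K_def] \<theta>(1) \<rho>(2) near window])
    finally show ?thesis by (simp add: X_def algebra_simps)
  qed
  have "exp c ^ n * \<bar>D j x0\<bar> \<le> \<bar>D j (X n)\<bar>" for n
  proof (induction n)
    case 0
    then show ?case using x by (simp add: X_def forward_solution_def)
  next
    case (Suc n)
    from Suc have "exp c * (exp c ^ n * \<bar>D j x0\<bar>) \<le> exp c * \<bar>D j (X n)\<bar>"
        by (rule mult_left_mono) simp
    also have "\<dots> \<le> \<bar>D j (X (Suc n))\<bar>" by (rule grow)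
    finally show ?case by (simp add: mult.assoc)
  qed
  moreover have "\<bar>D j (X n)\<bar> \<le> B" for n
  proof -
    have "infdist (X n) \<Gamma> < \<epsilon>" unfolding X_def using T_pos by (intro tube) simp
    then show ?thesis using B[of "X n"] \<epsilon> \<rho> by (simp add: K_def)
  qed
  ultimately have bounded: "exp c ^ n \<le> B / \<bar>D j x0\<bar>" for n
    using x0(3) by (simp add: pos_le_divide_eq) (meson order_trans)
  obtain n where "B / \<bar>D j x0\<bar> < exp c ^ n"
    using real_arch_pow[of "exp c"] c by auto
  then show False using bounded[of n] by simp
qed

end

section \<open>The perturbed system\<close>

lemma lip_on_compacts_nth:
  fixes f :: "'a::metric_space \<Rightarrow> ('b::metric_space)^'m"
  assumes "lip_on_compacts V f"
  shows "lip_on_compacts V (\<lambda>x. f x $ i)"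
  unfolding lip_on_compacts_def
proof (intro allI impI)
  fix K assume K: "compact K" "K \<subseteq> V"
  obtain L where L: "L \<ge> 0" "L-lipschitz_on K f" by (rule lip_on_compactsE[OF assms K])
  have "L-lipschitz_on K (\<lambda>x. f x $ i)"
    using L(1) by (intro lipschitz_onI) (auto intro:
        order_trans[OF dist_vec_nth_le lipschitz_onD[OF L(2)]])
  then show "\<exists>L. L-lipschitz_on K (\<lambda>x. f x $ i)" by blast
qed

lemma lip_on_compacts_grad:
  fixes f :: "real^'n \<Rightarrow> real"
  assumes "smooth_on V f" "open V"
  shows "lip_on_compacts V (grad f)"
  using smooth_on_grad_lip[OF assms, of "axis _ 1"]
  by (intro lip_on_compacts_vec) (simp add: inner_axis' )

lemma lip_on_compacts_wedge:
  fixes \<alpha> \<beta> :: "'a::metric_space \<Rightarrow> 'n::{finite,linorder} multivector"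
  assumes "lip_on_compacts V \<alpha>" "lip_on_compacts V \<beta>"
  shows "lip_on_compacts V (\<lambda>x. wedge (\<alpha> x) (\<beta> x))"
  unfolding wedge_def
  by (rule lip_on_compacts_vec)
     (simp, intro lip_on_compacts_sum lip_on_compacts_mult lip_on_compacts_const
         lip_on_compacts_nth assms)

lemma lip_on_compacts_of_vector:
  assumes "lip_on_compacts V f"
  shows "lip_on_compacts V (\<lambda>x. of_vector (f x))"
  unfolding of_vector_def
  by (intro lip_on_compacts_sum lip_on_compacts_scaleR lip_on_compacts_const lip_on_compacts_nth
      assms)

lemma lip_on_compacts_hodge:
  fixes \<alpha> :: "'a::metric_space \<Rightarrow> 'n::{finite,linorder} multivector"
  assumes "lip_on_compacts V \<alpha>"
  shows "lip_on_compacts V (\<lambda>x. hodge (\<alpha> x))"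
  unfolding hodge_def
  by (rule lip_on_compacts_vec)
     (simp, intro lip_on_compacts_mult lip_on_compacts_const lip_on_compacts_nth assms)

lemma lip_on_compacts_vector_part:
  assumes "lip_on_compacts V \<alpha>"
  shows "lip_on_compacts V (\<lambda>x. vector_part (\<alpha> x))"
  unfolding vector_part_def
  by (rule lip_on_compacts_vec) (simp, intro lip_on_compacts_nth assms)

lemma lip_on_compacts_wedge_list:
  fixes gs :: "('a::metric_space \<Rightarrow> real^'n::{finite,linorder}) list"
  assumes "\<And>g. g \<in> set gs \<Longrightarrow> lip_on_compacts V g"
  shows "lip_on_compacts V (\<lambda>x. wedge_list (map (\<lambda>g. g x) gs))"
  using assms
proof (induction gs)
  case Nil
  then show ?case by (simp add: wedge_list_def)
next
  case (Cons g gs)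
  then show ?case by (auto intro!: lip_on_compacts_wedge lip_on_compacts_of_vector)
qed

lemma lip_on_compacts_wedge_grads:
  fixes I D :: "nat \<Rightarrow> real^'n::{finite,linorder} \<Rightarrow> real"
  assumes "open V" "\<And>j. j \<in> set js \<Longrightarrow> smooth_on V (D j)" "\<And>l. l \<in> set ls \<Longrightarrow> smooth_on V (I l)"
  shows "lip_on_compacts V (\<lambda>x. wedge_list (map (\<lambda>j. grad (D j) x) js @ map (\<lambda>l. grad (I l) x) ls))"
proof -
  have "lip_on_compacts V (\<lambda>x. wedge_list (map (\<lambda>g. g x) (map (\<lambda>j. grad (D j)) js @
      map (\<lambda>l. grad (I l)) ls)))"
    by (rule lip_on_compacts_wedge_list) (use assms in \<open>auto intro: lip_on_compacts_grad\<close>)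
  then show ?thesis by (simp add: o_def)
qed

lemma lip_on_compacts_norm_power2:
  fixes f :: "'a::metric_space \<Rightarrow> real^'m"
  assumes "lip_on_compacts V f"
  shows "lip_on_compacts V (\<lambda>x. (norm (f x))\<^sup>2)"
  unfolding power2_norm_eq_inner inner_vec_def inner_real_def
  by (intro lip_on_compacts_sum lip_on_compacts_mult lip_on_compacts_nth assms)

text \<open>The coefficients of \<open>X\<^sub>0\<close> are polynomials in smooth functions and their first derivatives,
  divided by the squared norm of the full wedge, which has no zeros.\<close>

lemma lip_on_compacts_X0:
  fixes I D u :: "nat \<Rightarrow> real^'n::{finite,linorder} \<Rightarrow> real"
  assumes V: "open V" and D: "\<And>j. j \<in> {1..p} \<Longrightarrow> smooth_on V (D j)"
    and I: "\<And>l. l \<in> {1..k} \<Longrightarrow> smooth_on V (I l)"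
    and u: "\<And>j. j \<in> {1..p} \<Longrightarrow> smooth_on V (u j)"
    and W: "\<And>x. x \<in> V \<Longrightarrow> full_wedge k p I D x \<noteq> 0"
  shows "lip_on_compacts V (X0 k p I D u)"
proof -
  have W_lip: "lip_on_compacts V (full_wedge k p I D)"
    unfolding full_wedge_def[abs_def] using D I by (intro lip_on_compacts_wedge_grads V) auto
  have Theta_lip: "lip_on_compacts V (Theta k p I D i)" for i
    unfolding Theta_def[abs_def] using D I
    by (intro lip_on_compacts_vector_part lip_on_compacts_hodge lip_on_compacts_wedge
         lip_on_compacts_wedge_grads V W_lip) auto
  show ?thesis
    unfolding X0_def[abs_def] using W D u
    by (intro lip_on_compacts_scaleR lip_on_compacts_inverse lip_on_compacts_norm_power2 W_lip
        lip_on_compacts_sum lip_on_compacts_mult lip_on_compacts_const Theta_lip)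
       (auto intro: smooth_on_imp_lip_on_compacts V)
qed

text \<open>Over \<open>[0, T]\<close> the hypotheses say that \<open>\<gamma>\<close> lies on \<open>I = D = 0\<close> and that its velocity and
  the gradients form a basis; periodicity extends this to all times. On the orbit \<open>X\<^sub>0\<close> vanishes
  with the \<open>D\<^sub>j\<close>, so the velocity is also that of the perturbed field.\<close>

lemma dissipative_perturbation:
  fixes U V :: "(real^'n::{finite,linorder}) set"
    and X :: "real^'n::{finite,linorder} \<Rightarrow> real^'n::{finite,linorder}"
    and I D u :: "nat \<Rightarrow> real^'n::{finite,linorder} \<Rightarrow> real"
  assumes X: "smooth_on U X" and kp: "k + p = CARD('n) - 1"
    and I: "\<forall>i\<in>{1..k}. first_integral U X (I i)"
    and D: "\<forall>j\<in>{1..p}. first_integral U X (D j)"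
    and V: "open V" "V \<subseteq> U"
    and indep: "\<forall>x\<in>V. lin_indep_list
           (map (\<lambda>i. grad (I i) x) [1..<Suc k] @ map (\<lambda>j. grad (D j) x) [1..<Suc p])"
    and orbit: "periodic_orbit V X T \<gamma>"
    and zero: "\<gamma> ` {0..T} \<subseteq> fibre V (k + p) (append_map k I D) (\<lambda>_. 0)"
    and frame: "\<forall>t\<in>{0..T}. lin_indep_list
           (map (\<lambda>i. grad (I i) (\<gamma> t)) [1..<Suc k] @
            map (\<lambda>j. grad (D j) (\<gamma> t)) [1..<Suc p] @ [X (\<gamma> t)])"
    and u: "\<forall>j\<in>{1..p}. smooth_on V (u j)"
  shows "dissipative_cycle V (\<lambda>x. X x + X0 k p I D u x) T \<gamma> k p I D u"
proof -
  have X_lip: "lip_on_compacts V X"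
    using smooth_on_imp_lip_on_compacts[OF smooth_on_subset[OF X V(2)] V(1)] .
  interpret X: cycle V X T \<gamma>
    by standard (use V X_lip orbit in auto)
  have I_smooth: "smooth_on V (I i)" and X_I: "x \<in> V \<Longrightarrow> X x \<bullet> grad (I i) x = 0" if "i \<in> {1..k}"
      for i x
    using I that V(2) smooth_on_subset unfolding first_integral_def lie_derivative_def by blast+
  have D_smooth: "smooth_on V (D j)" and X_D: "x \<in> V \<Longrightarrow> X x \<bullet> grad (D j) x = 0" if "j \<in> {1..p}"
      for j x
    using D that V(2) smooth_on_subset unfolding first_integral_def lie_derivative_def by blast+
  have W: "full_wedge k p I D x \<noteq> 0" if "x \<in> V" for x
    unfolding full_wedge_def using indep that
        by (intro wedge_list_nonzero) (simp only: lin_indep_list_swap)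
  have p: "p < CARD('n)" using kp zero_less_card_finite[where 'a='n] by linarith
  define Y where "Y = (\<lambda>x. X x + X0 k p I D u x)"
  have F_zero: "append_map k I D i (\<gamma> t) = 0" if "i \<in> {1..k+p}" for i t
  proof -
    obtain s where s: "s \<in> {0..T}" "\<gamma> t = \<gamma> s" by (rule X.orbit_mod)
    then have "\<gamma> t \<in> fibre V (k + p) (append_map k I D) (\<lambda>_. 0)" using zero by auto
    then show ?thesis using that by (simp add: fibre_def)
  qed
  have I_zero: "I i (\<gamma> t) = 0" if "i \<in> {1..k}" for i t
    using F_zero[of i t] that by (simp add: append_map_def)
  have D_zero: "D j (\<gamma> t) = 0" if "j \<in> {1..p}" for j t
    using F_zero[of "k + j" t] that by (simp add: append_map_def split: if_splits)
  have Y_orbit: "Y (\<gamma> t) = X (\<gamma> t)" for t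
    using D_zero by (simp add: Y_def X0_def)
  have "dissipative_cycle V Y T \<gamma> k p I D u"
  proof
    show "open V" by (rule V)
    show "lip_on_compacts V Y"
      unfolding Y_def using D_smooth I_smooth u W
      by (intro lip_on_compacts_add X_lip lip_on_compacts_X0 V) auto
    show "periodic_orbit V Y T \<gamma>"
      using orbit Y_orbit by (simp add: periodic_orbit_def)
    show "codim_one_dissipative V Y k p I D u"
      unfolding codim_one_dissipative_def lie_derivative_def Y_def inner_add_left
      using kp I_smooth D_smooth u by (auto simp: X_I X_D inner_X0_I inner_X0_D[OF p] W)
    show "I i (\<gamma> t) = 0" if "i \<in> {1..k}" for i t using I_zero[OF that] .
    show "D j (\<gamma> t) = 0" if "j \<in> {1..p}" for j t using D_zero[OF that] .
    fix t
    obtain s where "s \<in> {0..T}" "\<gamma> t = \<gamma> s" by (rule X.orbit_mod)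
    then show "lin_indep_list (map (\<lambda>i. grad (I i) (\<gamma> t)) [1..<Suc k] @
            map (\<lambda>j. grad (D j) (\<gamma> t)) [1..<Suc p] @ [Y (\<gamma> t)])"
      using frame by (simp only: Y_orbit)
  qed
  then show ?thesis by (simp only: Y_def)
qed

theorem theorem5p1:
  fixes U V :: "(real^'n::{finite,linorder}) set"
    and X :: "real^'n::{finite,linorder} \<Rightarrow> real^'n::{finite,linorder}"
    and k p :: nat
    and I D :: "nat \<Rightarrow> real^'n::{finite,linorder} \<Rightarrow> real"
    and T :: real
    and \<gamma> :: "real \<Rightarrow> real^'n::{finite,linorder}"
  assumes "open U"
    and "smooth_on U X"
    and "completely_integrable U X"
    and "k + p = CARD('n) - 1"
    and "\<forall>i\<in>{1..k}. first_integral U X (I i)"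
    and "\<forall>j\<in>{1..p}. first_integral U X (D j)"
    and "open V" and "V \<subseteq> U"
    and "\<forall>x\<in>V. lin_indep_list
           (map (\<lambda>i. grad (I i) x) [1..<Suc k] @ map (\<lambda>j. grad (D j) x) [1..<Suc p])"
    and "periodic_orbit V X T \<gamma>"
    and "\<gamma> ` {0..T} \<subseteq> fibre V (k + p) (append_map k I D) (\<lambda>_. 0)"
    and "regular_value V (k + p) (append_map k I D) (\<lambda>_. 0)"
    and "\<forall>t\<in>{0..T}. lin_indep_list
           (map (\<lambda>i. grad (I i) (\<gamma> t)) [1..<Suc k] @
            map (\<lambda>j. grad (D j) (\<gamma> t)) [1..<Suc p] @ [X (\<gamma> t)])"
  shows
    "(regular_value V k I (\<lambda>_. 0) \<longrightarrow>
       (\<forall>h :: nat \<Rightarrow> real^'n::{finite,linorder} \<Rightarrow> real.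
          (\<forall>j\<in>{1..p}. smooth_on V (h j) \<and> integral {0..T} (\<lambda>s. h j (\<gamma> s)) < 0) \<longrightarrow>
          (let Y = (\<lambda>x. X x + X0 k p I D h x) in
             codim_one_dissipative V Y k p I D h \<and>
             periodic_orbit V Y T \<gamma> \<and>
             orbitally_phase_asymptotically_stable V Y (fibre V k I (\<lambda>_. 0)) T \<gamma>)))
     \<and>
     (\<forall>\<kappa> :: nat \<Rightarrow> real^'n::{finite,linorder} \<Rightarrow> real.
          (\<forall>j\<in>{1..p}. smooth_on V (\<kappa> j)) \<and>
          (\<exists>i0\<in>{1..p}. integral {0..T} (\<lambda>s. \<kappa> i0 (\<gamma> s)) > 0) \<longrightarrow>
          (let Y = (\<lambda>x. X x + X0 k p I D \<kappa> x) in
             codim_one_dissipative V Y k p I D \<kappa> \<and>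
             periodic_orbit V Y T \<gamma> \<and>
             unstable V Y (\<gamma> ` {0..T})))"
proof (rule conjI)
  note cyc = dissipative_perturbation[OF assms(2,4,5,6,7,8,9,10,11,13)]
  show "regular_value V k I (\<lambda>_. 0) \<longrightarrow>
       (\<forall>h :: nat \<Rightarrow> real^'n::{finite,linorder} \<Rightarrow> real.
          (\<forall>j\<in>{1..p}. smooth_on V (h j) \<and> integral {0..T} (\<lambda>s. h j (\<gamma> s)) < 0) \<longrightarrow>
          (let Y = (\<lambda>x. X x + X0 k p I D h x) in
             codim_one_dissipative V Y k p I D h \<and>
             periodic_orbit V Y T \<gamma> \<and>
             orbitally_phase_asymptotically_stable V Y (fibre V k I (\<lambda>_. 0)) T \<gamma>))"
    unfolding Let_def
  proof (intro impI allI)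
    fix h :: "nat \<Rightarrow> real^'n::{finite,linorder} \<Rightarrow> real"
    assume h: "\<forall>j\<in>{1..p}. smooth_on V (h j) \<and> integral {0..T} (\<lambda>s. h j (\<gamma> s)) < 0"
    then interpret dissipative_cycle V "\<lambda>x. X x + X0 k p I D h x" T \<gamma> k p I D h
      by (intro cyc) blast
    show "codim_one_dissipative V (\<lambda>x. X x + X0 k p I D h x) k p I D h \<and>
             periodic_orbit V (\<lambda>x. X x + X0 k p I D h x) T \<gamma> \<and>
             orbitally_phase_asymptotically_stable V (\<lambda>x. X x
                 + X0 k p I D h x) (fibre V k I (\<lambda>_. 0)) T \<gamma>"
      using dissipative orbit phase_asymptotically_stable h by blast
  qed
  show "\<forall>\<kappa> :: nat \<Rightarrow> real^'n::{finite,linorder} \<Rightarrow> real.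
          (\<forall>j\<in>{1..p}. smooth_on V (\<kappa> j)) \<and>
          (\<exists>i0\<in>{1..p}. integral {0..T} (\<lambda>s. \<kappa> i0 (\<gamma> s)) > 0) \<longrightarrow>
          (let Y = (\<lambda>x. X x + X0 k p I D \<kappa> x) in
             codim_one_dissipative V Y k p I D \<kappa> \<and>
             periodic_orbit V Y T \<gamma> \<and>
             unstable V Y (\<gamma> ` {0..T}))"
    unfolding Let_def
  proof (intro impI allI)
    fix \<kappa> :: "nat \<Rightarrow> real^'n::{finite,linorder} \<Rightarrow> real"
    assume \<kappa>: "(\<forall>j\<in>{1..p}. smooth_on V (\<kappa> j)) \<and> (\<exists>i0\<in>{1..p}. integral {0..T} (\<lambda>s. \<kappa> i0 (\<gamma> s)) > 0)"
    then interpret dissipative_cycle V "\<lambda>x. X x + X0 k p I D \<kappa> x" T \<gamma> k p I D \<kappa>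
      by (intro cyc) blast
    show "codim_one_dissipative V (\<lambda>x. X x + X0 k p I D \<kappa> x) k p I D \<kappa> \<and>
             periodic_orbit V (\<lambda>x. X x + X0 k p I D \<kappa> x) T \<gamma> \<and>
             unstable V (\<lambda>x. X x + X0 k p I D \<kappa> x) (\<gamma> ` {0..T})"
      using dissipative orbit cycle_unstable \<kappa> unfolding \<Gamma>_def by blast
  qed
qed

end
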